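(* Assume that $$\max\{\Lambda_{\mu_L}(\lambda),\Lambda_{\mu_R}(\lambda)\}=\begin{cases}\Lambda_{\overline{\mu}}(\lambda),&\lambda\ge0,\\ \Lambda_{\underline{\mu}}(\lambda),&\lambda<0.\end{cases}$$ For $n\ge1$ and Borel sets $A\subseteq\mathbb{R}$ set $$\nu_n(A)=\sup_{\theta\in\Theta}P\left(\frac{S_n^{\theta}}{n}\in A\right).$$ Then the family $\{\nu_n:n\ge1\}$ satisfies a large deviation principle on $\mathbb{R}$ with speed $n$ and rate function $$I(x)=\begin{cases}\Lambda^{*}_{\overline{\mu}}(x),&x>\overline{\mu},\\ \Lambda^{*}_{\underline{\mu}}(x),&x<\underline{\mu},\\ 0,&x\in[\underline{\mu},\overline{\mu}],\end{cases}$$ where $\Lambda^{*}_{\overline{\mu}}(x)=\sup_{\lambda\in\mathbb{R}}\{\lambda x-\Lambda_{\overline{\mu}}(\lambda)\}$ and $\Lambda^{*}_{\underline{\mu}}(x)=\sup_{\lambda\in\mathbb{R}}\{\lambda x-\Lambda_{\underline{\mu}}(\lambda)\}$ for $x\in\mathbb{R}$. Namely, for every closed set $F\subseteq\mathbb{R}$, $$\limsup_{n\to\infty}\frac1n\log\nu_n(F)\le-\inf_{x\in F}I(x),$$ and for every open set $G\subseteq\mathbb{R}$, $$\liminf_{n\to\infty}\frac1n\log\nu_n(G)\ge-\inf_{x\in G}I(x).$$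
   Context: Setting (two-armed bandit). Let $(\Omega,\mathcal{F},P)$ be a probability space and $W^L,W^R$ real random variables with finite means $\mu_L,\mu_R$ and finite variances $\sigma_L^2,\sigma_R^2$. Let $\{W_i^L\}_{i\ge1}$ and $\{W_i^R\}_{i\ge1}$ be sequences of i.i.d. copies of $W^L$ and $W^R$ respectively, the two sequences being independent of each other. Put $\overline{\mu}=\max\{\mu_L,\mu_R\}$, $\underline{\mu}=\min\{\mu_L,\mu_R\}$. A sampling strategy is a sequence $\theta=(\vartheta_1,\vartheta_2,\dots)$ of $\{1,2\}$-valued random variables; the reward at round $i$ is $Z_i^{\theta}=W_i^L$ if $\vartheta_i=1$ and $Z_i^\theta=W_i^R$ if $\vartheta_i=2$. Let $\mathcal{H}_n^{\theta}=\sigma\{Z_1^{\theta},\dots,Z_n^{\theta}\}$, $\mathcal{H}_0^{\theta}=\{\emptyset,\Omega\}$. The strategy $\theta$ is admissible if $\vartheta_n$ is $\mathcal{H}_{n-1}^{\theta}$-measurable for all $n\ge1$; $\Theta$ is the set of all admissible strategies. Put $S_n^{\theta}=\sum_{i=1}^nZ_i^{\theta}$. For $\lambda\in\mathbb{R}$ put $\Lambda_{\mu_L}(\lambda)=\log E_P[e^{\lambda W^L}]$ and $\Lambda_{\mu_R}(\lambda)=\log E_P[e^{\lambda W^R}]$ (values in $(-\infty,+\infty]$). $\Lambda_{\overline{\mu}}$ denotes the logarithmic moment generating function of the arm with the larger mean and $\Lambda_{\underline{\mu}}$ that of the arm with the smaller mean: $(\Lambda_{\overline{\mu}},\Lambda_{\underline{\mu}})=(\Lambda_{\mu_L},\Lambda_{\mu_R})$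 if $\mu_L\ge\mu_R$, and $(\Lambda_{\mu_R},\Lambda_{\mu_L})$ if $\mu_L<\mu_R$. Conventions: $\log0=-\infty$, $\inf\emptyset=+\infty$. *)

theory Defs
  imports "HOL-Probability.Probability"
begin

text \<open>
  All sequences are indexed by the rounds \<open>i \<ge> 1\<close>; the values at index \<open>0\<close> are irrelevant.
  \<open>M\<close> is the underlying probability space, \<open>WL\<close>, \<open>WR\<close> are the two arms, and \<open>XL\<close>, \<open>XR\<close> are the
  sequences of their copies.
\<close>

definition iid_copies :: "'a measure \<Rightarrow> ('a \<Rightarrow> real) \<Rightarrow> (nat \<Rightarrow> 'a \<Rightarrow> real) \<Rightarrow> bool" where
  "iid_copies M W X \<longleftrightarrow>
     prob_space.indep_vars M (\<lambda>_. borel) X {1..} \<and>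
     (\<forall>i\<ge>1. distr M borel (X i) = distr M borel W)"

definition indep_sequences :: "'a measure \<Rightarrow> (nat \<Rightarrow> 'a \<Rightarrow> real) \<Rightarrow> (nat \<Rightarrow> 'a \<Rightarrow> real) \<Rightarrow> bool" where
  "indep_sequences M X Y \<longleftrightarrow>
     prob_space.indep_var M
       (\<Pi>\<^sub>M i\<in>{1..}. borel) (\<lambda>\<omega>. \<lambda>i\<in>{1..}. X i \<omega>)
       (\<Pi>\<^sub>M i\<in>{1..}. borel) (\<lambda>\<omega>. \<lambda>i\<in>{1..}. Y i \<omega>)"

definition reward ::
  "(nat \<Rightarrow> 'a \<Rightarrow> real) \<Rightarrow> (nat \<Rightarrow> 'a \<Rightarrow> real) \<Rightarrow> (nat \<Rightarrow> 'a \<Rightarrow> nat) \<Rightarrow> nat \<Rightarrow> 'a \<Rightarrow> real" where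
  "reward XL XR \<theta> i \<omega> = (if \<theta> i \<omega> = 1 then XL i \<omega> else XR i \<omega>)"

text \<open>The \<open>\<sigma>\<close>-algebra generated by the first \<open>n\<close> rewards; it is trivial for \<open>n = 0\<close>.\<close>

definition history ::
  "'a measure \<Rightarrow> (nat \<Rightarrow> 'a \<Rightarrow> real) \<Rightarrow> (nat \<Rightarrow> 'a \<Rightarrow> real) \<Rightarrow> (nat \<Rightarrow> 'a \<Rightarrow> nat) \<Rightarrow> nat \<Rightarrow> 'a measure" where
  "history M XL XR \<theta> n =
     sigma (space M) {reward XL XR \<theta> i -` B \<inter> space M | i B. i \<in> {1..n} \<and> B \<in> sets borel}"

text \<open>Measurability into \<^term>\<open>count_space {1, 2 :: nat}\<close> includes that the values on
  \<^term>\<open>space M\<close> lie in \<^term>\<open>{1, 2 :: nat}\<close>.\<close>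

definition admissible_strategies ::
  "'a measure \<Rightarrow> (nat \<Rightarrow> 'a \<Rightarrow> real) \<Rightarrow> (nat \<Rightarrow> 'a \<Rightarrow> real) \<Rightarrow> (nat \<Rightarrow> 'a \<Rightarrow> nat) set" where
  "admissible_strategies M XL XR =
     {\<theta>. (\<forall>n\<ge>1. \<theta> n \<in> measurable M (count_space {1, 2})) \<and>
         (\<forall>n\<ge>1. \<theta> n \<in> measurable (history M XL XR \<theta> (n - 1)) (count_space {1, 2}))}"

definition total_reward ::
  "(nat \<Rightarrow> 'a \<Rightarrow> real) \<Rightarrow> (nat \<Rightarrow> 'a \<Rightarrow> real) \<Rightarrow> (nat \<Rightarrow> 'a \<Rightarrow> nat) \<Rightarrow> nat \<Rightarrow> 'a \<Rightarrow> real" where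
  "total_reward XL XR \<theta> n \<omega> = (\<Sum>i=1..n. reward XL XR \<theta> i \<omega>)"

definition sup_prob ::
  "'a measure \<Rightarrow> (nat \<Rightarrow> 'a \<Rightarrow> real) \<Rightarrow> (nat \<Rightarrow> 'a \<Rightarrow> real) \<Rightarrow> nat \<Rightarrow> real set \<Rightarrow> ennreal" where
  "sup_prob M XL XR n A =
     (SUP \<theta>\<in>admissible_strategies M XL XR.
        emeasure M {\<omega> \<in> space M. total_reward XL XR \<theta> n \<omega> / real n \<in> A})"

definition log_ennreal :: "ennreal \<Rightarrow> ereal" where
  "log_ennreal x = (if x = 0 then -\<infinity> else if x = \<infinity> then \<infinity> else ereal (ln (enn2real x)))"

definition log_mgf :: "'a measure \<Rightarrow> ('a \<Rightarrow> real) \<Rightarrow> real \<Rightarrow> ereal" where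
  "log_mgf M W t = log_ennreal (\<integral>\<^sup>+\<omega>. ennreal (exp (t * W \<omega>)) \<partial>M)"

text \<open>The logarithmic moment generating functions of the arm with the larger and of the arm with
  the smaller mean; for equal means these are \<open>WL\<close> and \<open>WR\<close>, respectively.\<close>

definition log_mgf_upper :: "'a measure \<Rightarrow> ('a \<Rightarrow> real) \<Rightarrow> ('a \<Rightarrow> real) \<Rightarrow> real \<Rightarrow> ereal" where
  "log_mgf_upper M WL WR =
     (if integral\<^sup>L M WL \<ge> integral\<^sup>L M WR then log_mgf M WL else log_mgf M WR)"

definition log_mgf_lower :: "'a measure \<Rightarrow> ('a \<Rightarrow> real) \<Rightarrow> ('a \<Rightarrow> real) \<Rightarrow> real \<Rightarrow> ereal" where
  "log_mgf_lower M WL WR =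
     (if integral\<^sup>L M WL \<ge> integral\<^sup>L M WR then log_mgf M WR else log_mgf M WL)"

definition legendre :: "(real \<Rightarrow> ereal) \<Rightarrow> real \<Rightarrow> ereal" where
  "legendre \<Lambda> x = (SUP t::real. ereal (t * x) - \<Lambda> t)"

definition bandit_rate :: "'a measure \<Rightarrow> ('a \<Rightarrow> real) \<Rightarrow> ('a \<Rightarrow> real) \<Rightarrow> real \<Rightarrow> ereal" where
  "bandit_rate M WL WR x =
     (if x > max (integral\<^sup>L M WL) (integral\<^sup>L M WR) then legendre (log_mgf_upper M WL WR) x
      else if x < min (integral\<^sup>L M WL) (integral\<^sup>L M WR) then legendre (log_mgf_lower M WL WR) x
      else 0)"

text \<open>A rate function is a lower semicontinuous function with values in \<open>[0, \<infinity>]\<close>.\<close>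

definition rate_function :: "('b::topological_space \<Rightarrow> ereal) \<Rightarrow> bool" where
  "rate_function I \<longleftrightarrow> (\<forall>x. 0 \<le> I x) \<and> (\<forall>a::real. closed {x. I x \<le> ereal a})"

text \<open>The large deviation principle with speed \<open>s\<close>, for set functions \<open>\<nu> n\<close> that need not be
  additive. The infimum of the empty set in \<^typ>\<open>ereal\<close> is \<open>\<infinity>\<close>.\<close>

definition large_deviation_principle ::
  "(nat \<Rightarrow> real) \<Rightarrow> (nat \<Rightarrow> 'b::topological_space set \<Rightarrow> ennreal) \<Rightarrow> ('b \<Rightarrow> ereal) \<Rightarrow> bool" where
  "large_deviation_principle s \<nu> I \<longleftrightarrow>
     rate_function I \<and>
     (\<forall>F. closed F \<longrightarrow>
        limsup (\<lambda>n. ereal (1 / s n) * log_ennreal (\<nu> n F)) \<le> - (INF x\<in>F. I x)) \<and>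
     (\<forall>G. open G \<longrightarrow>
        liminf (\<lambda>n. ereal (1 / s n) * log_ennreal (\<nu> n G)) \<ge> - (INF x\<in>G. I x))"

end

theory Submission
  imports Defs
begin

text \<open>
  Under the assumption on the moment generating functions the rate function is the Legendre
  transform of \<open>\<Lambda> = max \<Lambda>\<^sub>L \<Lambda>\<^sub>R\<close>, since the terms \<open>t x - \<Lambda> t\<close> with the wrong sign of \<open>t\<close> are nonpositive.
  The choice of the arm in a round is independent of both outcomes of that round, so
  \<open>E exp (t S\<^sub>n) \<le> exp (n \<Lambda> t)\<close> for every admissible strategy, and Chernoff's inequality gives the
  upper bound. For the lower bound outside the interval of means always play the arm with the larger
  (or smaller) mean and use the lower bound in Cramer's theorem; inside the interval switch arms
  once, at a time that makes the mean reward right, and use Chebyshev's inequality.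

  Expectations \<open>E f (s + X\<^sub>1 + \<dots> + X\<^sub>n)\<close> are computed by iterating the one-step operator
  \<open>f \<mapsto> (\<lambda>s. \<integral> f (s + x) \<mu>(dx))\<close>. Truncation, exponential tilting and Chebyshev's inequality can then
  be done one step at a time, without densities on product spaces.
\<close>

subsection \<open>Random walks\<close>

text \<open>The generating functions may be infinite away from 0, so the lower bound cannot start
  from a minimiser of them. Restricting the steps to \<open>{-K..K}\<close>, without renormalising,
  gives finite continuous functions that increase with \<open>K\<close>. If the law charges both
  sides of 0, their sublevel sets are compact for large \<open>K\<close>, and a nested intersection
  argument shows that the infimum is recovered in the limit, up to the gap between \<open>c'\<close>
  and \<open>c\<close>. If one side has no mass, the infimum may be approached only as the parameter
  tends to infinity, which forces the separate argument with the atom at 0.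

  In the upper bound the same parameter must serve every strategy. It is therefore chosen from the
  closed set alone, one value for the part above the means and one for the part below; each fixed
  strategy is then estimated, and the supremum comes last.\<close>

definition walk_step :: "real measure \<Rightarrow> (real \<Rightarrow> ennreal) \<Rightarrow> real \<Rightarrow> ennreal" where
  "walk_step \<mu> f s = (\<integral>\<^sup>+x. f (s + x) \<partial>\<mu>)"

lemma walk_Suc: "(walk_step \<mu> ^^ Suc n) f s = (\<integral>\<^sup>+x. (walk_step \<mu> ^^ n) f (s + x) \<partial>\<mu>)"
  by (simp add: walk_step_def)

lemma walk_step_measurable:
  assumes "sigma_finite_measure \<mu>" and [measurable_cong]: "sets \<mu> = sets borel"
    and [measurable]: "f \<in> borel_measurable borel"
  shows "walk_step \<mu> f \<in> borel_measurable borel"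
proof -
  interpret sigma_finite_measure \<mu> by fact
  show ?thesis unfolding walk_step_def[abs_def] by measurable
qed

lemma walk_measurable:
  assumes "sigma_finite_measure \<mu>" "sets \<mu> = sets borel" "f \<in> borel_measurable borel"
  shows "(walk_step \<mu> ^^ n) f \<in> borel_measurable borel"
  using assms by (induction n) (auto intro: walk_step_measurable)

lemma walk_mono:
  assumes "\<And>s. f s \<le> g s"
  shows "(walk_step \<mu> ^^ n) f s \<le> (walk_step \<mu> ^^ n) g s"
  using assms by (induction n arbitrary: s) (auto simp: walk_step_def intro!: nn_integral_mono)

text \<open>Restricting the step law to \<open>A\<close> discards the paths that ever make a step
  outside \<open>A\<close>. Nothing is renormalised, so the comparison carries no constant.\<close>

lemma walk_density_indicator_le:
  assumes "sigma_finite_measure \<mu>" and S[measurable_cong]: "sets \<mu> = sets borel"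
    and [measurable]: "f \<in> borel_measurable borel" "A \<in> sets borel"
  shows "(walk_step (density \<mu> (indicator A)) ^^ n) f s \<le> (walk_step \<mu> ^^ n) f s"
proof (induction n arbitrary: s)
  case (Suc n)
  have [measurable]: "(walk_step \<mu> ^^ n) f \<in> borel_measurable borel"
    using assms by (intro walk_measurable) auto
  have "(walk_step (density \<mu> (indicator A)) ^^ Suc n) f s
      \<le> walk_step (density \<mu> (indicator A)) ((walk_step \<mu> ^^ n) f) s"
    by (auto simp: walk_step_def intro!: nn_integral_mono Suc)
  also have "\<dots> = (\<integral>\<^sup>+x. indicator A x * (walk_step \<mu> ^^ n) f (s + x) \<partial>\<mu>)"
    by (subst walk_step_def, subst nn_integral_density) auto
  also have "\<dots> \<le> (\<integral>\<^sup>+x. (walk_step \<mu> ^^ n) f (s + x) \<partial>\<mu>)"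
    by (intro nn_integral_mono) (auto split: split_indicator)
  finally show ?case by (simp add: walk_Suc del: funpow.simps)
qed simp

lemma walk_cmult:
  assumes "sigma_finite_measure \<mu>" "sets \<mu> = sets borel" "f \<in> borel_measurable borel"
  shows "(walk_step \<mu> ^^ n) (\<lambda>u. c * f u) s = c * (walk_step \<mu> ^^ n) f s"
proof (induction n arbitrary: s)
  case (Suc n)
  note [measurable_cong] = assms(2)
  have [measurable]: "(walk_step \<mu> ^^ n) f \<in> borel_measurable borel"
    using assms by (intro walk_measurable) auto
  have "(walk_step \<mu> ^^ Suc n) (\<lambda>u. c * f u) s = (\<integral>\<^sup>+x. c * (walk_step \<mu> ^^ n) f (s + x) \<partial>\<mu>)"
    unfolding walk_Suc Suc ..
  also have "\<dots> = c * (walk_step \<mu> ^^ Suc n) f s"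
    by (subst nn_integral_cmult) (auto simp: walk_Suc simp del: funpow.simps)
  finally show ?case .
qed simp

lemma walk_add:
  assumes "sigma_finite_measure \<mu>" "sets \<mu> = sets borel"
    and "f \<in> borel_measurable borel" "g \<in> borel_measurable borel"
  shows "(walk_step \<mu> ^^ n) (\<lambda>u. f u + g u) s = (walk_step \<mu> ^^ n) f s + (walk_step \<mu> ^^ n) g s"
proof (induction n arbitrary: s)
  case (Suc n)
  note [measurable_cong] = assms(2)
  have [measurable]: "(walk_step \<mu> ^^ n) f \<in> borel_measurable borel"
      "(walk_step \<mu> ^^ n) g \<in> borel_measurable borel"
    using assms by (auto intro: walk_measurable)
  have "(walk_step \<mu> ^^ Suc n) (\<lambda>u. f u + g u) s
      = (\<integral>\<^sup>+x. (walk_step \<mu> ^^ n) f (s + x) + (walk_step \<mu> ^^ n) g (s + x) \<partial>\<mu>)"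
    unfolding walk_Suc Suc ..
  also have "\<dots> = (walk_step \<mu> ^^ Suc n) f s + (walk_step \<mu> ^^ Suc n) g s"
    by (subst nn_integral_add) (auto simp: walk_Suc simp del: funpow.simps)
  finally show ?case .
qed simp

lemma walk_const:
  assumes "prob_space \<mu>"
  shows "(walk_step \<mu> ^^ n) (\<lambda>_. c) s = c"
proof -
  interpret prob_space \<mu> by fact
  show ?thesis
    by (induction n arbitrary: s) (simp_all add: walk_step_def emeasure_space_1)
qed

text \<open>In terms of \<open>\<nu>\<close> each step \<open>x\<close> carries the weight
  \<open>m * exp (- \<eta> * x)\<close>. Over \<open>n\<close> steps the exponents add up to the
  displacement of the walk, so the correction depends on the end point alone.\<close>

lemma walk_exponential_tilt:
  fixes \<mu> :: "real measure" and m \<eta> :: real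
  assumes "sigma_finite_measure \<mu>" and S[measurable_cong]: "sets \<mu> = sets borel"
    and f[measurable]: "f \<in> borel_measurable borel" and m: "m > 0"
  defines "\<nu> \<equiv> density \<mu> (\<lambda>x. ennreal (exp (\<eta> * x) / m))"
  assumes \<nu>: "sigma_finite_measure \<nu>"
  shows "(walk_step \<mu> ^^ n) f s
    = ennreal (m ^ n * exp (\<eta> * s)) * (walk_step \<nu> ^^ n) (\<lambda>u. ennreal (exp (- \<eta> * u)) * f u) s"
proof (induction n arbitrary: s)
  case 0
  have "ennreal (exp (\<eta> * s)) * (ennreal (exp (- (\<eta> * s))) * f s) = f s"
    by (simp add: mult.assoc[symmetric] ennreal_mult[symmetric] exp_add[symmetric])
  then show ?case by simp
next
  case (Suc n)
  define g where "g = (\<lambda>u. ennreal (exp (- \<eta> * u)) * f u)"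
  have [measurable]: "g \<in> borel_measurable borel" unfolding g_def by measurable
  have S': "sets \<nu> = sets borel" by (simp add: \<nu>_def S)
  have [measurable]: "(walk_step \<nu> ^^ n) g \<in> borel_measurable borel"
    using \<nu> S' by (intro walk_measurable) auto
  have "(walk_step \<mu> ^^ Suc n) f s
      = (\<integral>\<^sup>+x. ennreal (m ^ n * exp (\<eta> * (s + x))) * (walk_step \<nu> ^^ n) g (s + x) \<partial>\<mu>)"
    unfolding walk_Suc Suc g_def ..
  also have "\<dots> = (\<integral>\<^sup>+x. ennreal (m ^ Suc n * exp (\<eta> * s)) *
      (ennreal (exp (\<eta> * x) / m) * (walk_step \<nu> ^^ n) g (s + x)) \<partial>\<mu>)"
  proof (intro nn_integral_cong)
    fix x
    have "m ^ n * exp (\<eta> * (s + x)) = (m ^ Suc n * exp (\<eta> * s)) * (exp (\<eta> * x) / m)"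
      using m by (simp add: algebra_simps exp_add)
    then have "ennreal (m ^ n * exp (\<eta> * (s + x)))
        = ennreal (m ^ Suc n * exp (\<eta> * s)) * ennreal (exp (\<eta> * x) / m)"
      using m by (simp only:) (rule ennreal_mult; simp)
    then show "ennreal (m ^ n * exp (\<eta> * (s + x))) * (walk_step \<nu> ^^ n) g (s + x)
      = ennreal (m ^ Suc n * exp (\<eta> * s)) *
      (ennreal (exp (\<eta> * x) / m) * (walk_step \<nu> ^^ n) g (s + x))"
      by (simp only: mult.assoc)
  qed
  also have "\<dots> = ennreal (m ^ Suc n * exp (\<eta> * s)) *
      (\<integral>\<^sup>+x. ennreal (exp (\<eta> * x) / m) * (walk_step \<nu> ^^ n) g (s + x) \<partial>\<mu>)"
    by (subst nn_integral_cmult) auto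
  also have "(\<integral>\<^sup>+x. ennreal (exp (\<eta> * x) / m) * (walk_step \<nu> ^^ n) g (s + x) \<partial>\<mu>)
      = walk_step \<nu> ((walk_step \<nu> ^^ n) g) s"
    unfolding walk_step_def[of _ "(walk_step \<nu> ^^ n) g"] by (subst (2) \<nu>_def, subst nn_integral_density) auto
  finally show ?case unfolding g_def by simp
qed

text \<open>Additivity of the variance: the cross term \<open>2 * s * x\<close> integrates to 0. The
  first step moves the starting point, hence the general \<open>s\<close>.\<close>

lemma walk_square:
  fixes \<nu> :: "real measure"
  assumes "prob_space \<nu>" and i2: "integrable \<nu> (\<lambda>x. x\<^sup>2)" and i1: "integrable \<nu> (\<lambda>x. x)"
    and m: "(\<integral>x. x \<partial>\<nu>) = 0"
  shows "(walk_step \<nu> ^^ n) (\<lambda>u. ennreal (u\<^sup>2)) s = ennreal (s\<^sup>2 + n * (\<integral>x. x\<^sup>2 \<partial>\<nu>))"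
proof (induction n arbitrary: s)
  case (Suc n)
  interpret prob_space \<nu> by fact
  let ?v = "\<integral>x. x\<^sup>2 \<partial>\<nu>"
  have v: "?v \<ge> 0" by simp
  have eq: "(s + x)\<^sup>2 + n * ?v = x\<^sup>2 + (2 * s * x + (s\<^sup>2 + n * ?v))" for x
    by (simp add: power2_eq_square algebra_simps)
  have int: "integrable \<nu> (\<lambda>x. (s + x)\<^sup>2 + n * ?v)"
    unfolding eq using i1 i2 by auto
  have "(walk_step \<nu> ^^ Suc n) (\<lambda>u. ennreal (u\<^sup>2)) s = (\<integral>\<^sup>+x. ennreal ((s + x)\<^sup>2 + n * ?v) \<partial>\<nu>)"
    unfolding walk_Suc Suc ..
  also have "\<dots> = ennreal (\<integral>x. (s + x)\<^sup>2 + n * ?v \<partial>\<nu>)"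
    using int v by (intro nn_integral_eq_integral) auto
  also have "(\<integral>x. (s + x)\<^sup>2 + n * ?v \<partial>\<nu>) = s\<^sup>2 + Suc n * ?v"
    unfolding eq using i1 i2 m by (simp add: algebra_simps prob_space)
  finally show ?case .
qed simp

lemma walk_chebyshev:
  fixes \<nu> :: "real measure"
  assumes "prob_space \<nu>" and S: "sets \<nu> = sets borel" and "integrable \<nu> (\<lambda>x. x\<^sup>2)" "integrable \<nu> (\<lambda>x. x)"
    and "(\<integral>x. x \<partial>\<nu>) = 0" and a: "a > 0"
  shows "(walk_step \<nu> ^^ n) (indicator {u. a \<le> \<bar>u\<bar>}) 0 \<le> ennreal (n * (\<integral>x. x\<^sup>2 \<partial>\<nu>) / a\<^sup>2)"
proof -
  interpret prob_space \<nu> by fact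
  have "(walk_step \<nu> ^^ n) (indicator {u. a \<le> \<bar>u\<bar>}) 0
      \<le> (walk_step \<nu> ^^ n) (\<lambda>u. ennreal (1 / a\<^sup>2) * ennreal (u\<^sup>2)) 0"
  proof (rule walk_mono)
    fix u :: real
    show "indicator {u. a \<le> \<bar>u\<bar>} u \<le> ennreal (1 / a\<^sup>2) * ennreal (u\<^sup>2)"
    proof (cases "a \<le> \<bar>u\<bar>")
      case True
      then have "a\<^sup>2 \<le> u\<^sup>2" using a by (simp add: abs_le_square_iff[symmetric])
      then show ?thesis using a True by (simp add: ennreal_mult[symmetric] ennreal_ge_1)
    qed simp
  qed
  also have "\<dots> = ennreal (1 / a\<^sup>2) * ennreal (n * (\<integral>x. x\<^sup>2 \<partial>\<nu>))"
    using walk_square[OF assms(1,3,4,5), of n 0]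
    by (subst walk_cmult) (auto simp: S intro: prob_space_imp_sigma_finite assms(1))
  also have "\<dots> = ennreal (n * (\<integral>x. x\<^sup>2 \<partial>\<nu>) / a\<^sup>2)"
    by (simp add: ennreal_mult[symmetric])
  finally show ?thesis .
qed

text \<open>The value \<open>1/2\<close> is a matter of convenience: a fixed positive constant
  disappears after taking logarithms and dividing by \<open>n\<close>.\<close>

lemma walk_concentration:
  fixes \<nu> :: "real measure" and \<delta> :: real
  assumes "prob_space \<nu>" and S: "sets \<nu> = sets borel" and "integrable \<nu> (\<lambda>x. x\<^sup>2)" "integrable \<nu> (\<lambda>x. x)"
    and "(\<integral>x. x \<partial>\<nu>) = 0" and \<delta>: "\<delta> > 0"
  shows "eventually (\<lambda>n. (walk_step \<nu> ^^ n) (indicator {u. \<bar>u\<bar> < n * \<delta>}) 0 \<ge> ennreal (1/2)) sequentially"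
proof -
  let ?v = "\<integral>x. x\<^sup>2 \<partial>\<nu>"
  have "(\<lambda>n. ?v / \<delta>\<^sup>2 / real n) \<longlonglongrightarrow> 0" by (rule lim_const_over_n)
  then have "eventually (\<lambda>n. ?v / \<delta>\<^sup>2 / real n < 1/2) sequentially"
    by (rule order_tendstoD) simp
  then show ?thesis using eventually_gt_at_top[of 0]
  proof eventually_elim
    case (elim n)
    let ?A = "(walk_step \<nu> ^^ n) (indicator {u. \<bar>u\<bar> < n * \<delta>}) 0"
    have eq: "real n * ?v / (n * \<delta>)\<^sup>2 = ?v / \<delta>\<^sup>2 / real n"
      using elim by (simp add: power2_eq_square field_simps)
    have le: "(walk_step \<nu> ^^ n) (indicator {u. n * \<delta> \<le> \<bar>u\<bar>}) 0 \<le> ennreal (1/2)"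
    proof -
      have "(walk_step \<nu> ^^ n) (indicator {u. n * \<delta> \<le> \<bar>u\<bar>}) 0 \<le> ennreal (n * ?v / (n * \<delta>)\<^sup>2)"
        using elim \<delta> by (intro walk_chebyshev assms) auto
      also have "\<dots> \<le> ennreal (1/2)"
        unfolding eq using elim by (intro ennreal_leI) simp
      finally show ?thesis .
    qed
    have "1 = (walk_step \<nu> ^^ n) (\<lambda>u. indicator {u. \<bar>u\<bar> < n * \<delta>} u + indicator {u. n * \<delta> \<le> \<bar>u\<bar>} u) 0"
      by (subst walk_const[OF assms(1), of n 1 0, symmetric])
         (rule arg_cong[where f="\<lambda>f. (walk_step \<nu> ^^ n) f 0"], auto split: split_indicator)
    also have "\<dots> = ?A + (walk_step \<nu> ^^ n) (indicator {u. n * \<delta> \<le> \<bar>u\<bar>}) 0"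
      by (subst walk_add) (auto simp: S intro: prob_space_imp_sigma_finite assms(1))
    also have "\<dots> \<le> ?A + ennreal (1/2)" using le by (rule add_left_mono)
    finally have "ennreal (1/2) + ennreal (1/2) \<le> ?A + ennreal (1/2)"
      by (subst ennreal_plus[symmetric]) auto
    then show ?case by (simp add: ennreal_add_left_cancel_le add.commute)
  qed
qed

subsection \<open>The lower bound in the theorem of Cramer\<close>

lemma exp_le_quadratic:
  fixes y :: real
  assumes "\<bar>y\<bar> \<le> 1"
  shows "exp y \<le> 1 + y + y\<^sup>2"
proof (cases "y \<ge> 0")
  case True
  then show ?thesis using assms by (intro exp_bound) auto
next
  case False
  have "1 - y \<le> exp (- y)" using exp_ge_add_one_self[of "- y"] by simp
  then have "(1 - y) * exp y \<le> exp (- y) * exp y" by (intro mult_right_mono) auto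
  also have "\<dots> = 1" by (simp add: exp_add[symmetric])
  \<comment> \<open>The product is \<open>1 - y^3\<close>, and \<open>y\<close> is negative.\<close>
  also have "1 \<le> (1 - y) * (1 + y + y\<^sup>2)"
    using False by (simp add: algebra_simps power2_eq_square mult_nonpos_nonneg mult_nonneg_nonpos zero_le_mult_iff mult_le_0_iff)
  finally show ?thesis using False by simp
qed

text \<open>At a minimiser of the moment generating function the tilted law has mean zero: compare the
  value at \<open>\<eta> + h\<close> with the bound \<open>exp (h x) \<le> 1 + h x + (h x)\<^sup>2\<close>.\<close>

lemma mean_zero_of_mgf_min:
  fixes \<nu> :: "real measure"
  assumes "prob_space \<nu>" and S[measurable_cong]: "sets \<nu> = sets borel" and K: "K > 0"
    and bd: "AE x in \<nu>. \<bar>x\<bar> \<le> K"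
    and min: "\<And>h. 1 \<le> (\<integral>x. exp (h * x) \<partial>\<nu>)"
  shows "(\<integral>x. x \<partial>\<nu>) = 0"
proof (rule ccontr)
  interpret prob_space \<nu> by fact
  let ?m = "\<integral>x. x \<partial>\<nu>"
  assume ne: "?m \<noteq> 0"
  have i1: "integrable \<nu> (\<lambda>x. x)"
    by (rule integrable_const_bound[where B=K]) (use bd in auto)
  have key: "h * ?m + h\<^sup>2 * K\<^sup>2 \<ge> 0" if h: "\<bar>h\<bar> * K \<le> 1" for h
  proof -
    have bound: "AE x in \<nu>. exp (h * x) \<le> 1 + h * x + h\<^sup>2 * K\<^sup>2"
      using bd
    proof eventually_elim
      case (elim x)
      have "\<bar>h * x\<bar> \<le> \<bar>h\<bar> * K"
        unfolding abs_mult using elim by (intro mult_left_mono) auto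
      then have le1: "\<bar>h * x\<bar> \<le> 1" using h by linarith
      have "exp (h * x) \<le> 1 + h * x + (h * x)\<^sup>2"
        using le1 by (rule exp_le_quadratic)
      moreover have "(h * x)\<^sup>2 \<le> h\<^sup>2 * K\<^sup>2"
      proof -
        have "x\<^sup>2 \<le> K\<^sup>2" using elim K by (simp add: abs_le_square_iff[symmetric])
        then show ?thesis by (simp add: power_mult_distrib mult_left_mono)
      qed
      ultimately show ?case by linarith
    qed
    have i2: "integrable \<nu> (\<lambda>x. exp (h * x))"
    proof (rule integrable_const_bound[where B="exp (\<bar>h\<bar> * K)"])
      show "AE x in \<nu>. norm (exp (h * x)) \<le> exp (\<bar>h\<bar> * K)"
        using bd
      proof eventually_elim
        case (elim x)
        have "h * x \<le> \<bar>h * x\<bar>" by simp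
        also have "\<dots> \<le> \<bar>h\<bar> * K" unfolding abs_mult using elim by (intro mult_left_mono) auto
        finally show ?case by simp
      qed
    qed auto
    have "1 \<le> (\<integral>x. exp (h * x) \<partial>\<nu>)" by (rule min)
    also have "\<dots> \<le> (\<integral>x. 1 + h * x + h\<^sup>2 * K\<^sup>2 \<partial>\<nu>)"
      using i1 i2 bound by (intro integral_mono_AE) auto
    also have "\<dots> = 1 + h * ?m + h\<^sup>2 * K\<^sup>2"
      using i1 by (simp add: prob_space)
    finally show ?thesis by simp
  qed
  \<comment> \<open>The test value is \<open>h = - c * ?m\<close>. The second bound gives
    \<open>\<bar>h\<bar> * K \<le> 1\<close>, as \<open>key\<close> demands; the first keeps the
    quadratic term at most half of the linear one, so the sum is negative.\<close>
  define c where "c = min (1 / (2 * K\<^sup>2)) (1 / (K * \<bar>?m\<bar>))"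
  have c: "c > 0" using K ne by (simp add: c_def)
  have "\<bar>- c * ?m\<bar> * K \<le> 1"
  proof -
    have "c \<le> 1 / (K * \<bar>?m\<bar>)" by (simp add: c_def)
    then have "c * (K * \<bar>?m\<bar>) \<le> 1" using K ne by (simp add: field_simps)
    then show ?thesis using c by (simp add: abs_mult mult_ac)
  qed
  from key[OF this] have "c * ?m\<^sup>2 \<le> c * (c * K\<^sup>2) * ?m\<^sup>2"
    by (simp add: power2_eq_square algebra_simps)
  moreover have "c * K\<^sup>2 \<le> 1/2"
  proof -
    have "c \<le> 1 / (2 * K\<^sup>2)" by (simp add: c_def)
    then show ?thesis using K by (simp add: field_simps)
  qed
  then have "c * (c * K\<^sup>2) * ?m\<^sup>2 \<le> c * (1/2) * ?m\<^sup>2"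
    using c by (intro mult_right_mono mult_left_mono) auto
  moreover have "c * ?m\<^sup>2 > 0" using c ne by simp
  ultimately show False by linarith
qed

text \<open>The law tilted at the minimiser \<open>\<eta>\<close> is centred, so its walk stays
  within \<open>n * \<delta>\<close> with probability at least \<open>1/2\<close> for large
  \<open>n\<close>. Undoing the tilt on that event costs at most
  \<open>exp (\<bar>\<eta>\<bar> * n * \<delta>)\<close>, besides the factor
  \<open>m ^ n\<close>.\<close>

lemma walk_lower_bound_bounded:
  fixes \<mu> :: "real measure" and \<delta> \<eta> m K :: real
  assumes "finite_measure \<mu>" and S[measurable_cong]: "sets \<mu> = sets borel" and K: "K > 0"
    and bd: "AE x in \<mu>. \<bar>x\<bar> \<le> K" and m: "m > 0"
    and mdef: "m = (\<integral>x. exp (\<eta> * x) \<partial>\<mu>)"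
    and min: "\<And>t. m \<le> (\<integral>x. exp (t * x) \<partial>\<mu>)"
    and \<delta>: "\<delta> > 0"
  shows "eventually (\<lambda>n. ennreal ((m * exp (- \<bar>\<eta>\<bar> * \<delta>)) ^ n / 2)
      \<le> (walk_step \<mu> ^^ n) (indicator {u. \<bar>u\<bar> < n * \<delta>}) 0) sequentially"
proof -
  interpret finite_measure \<mu> by fact
  have iexp: "integrable \<mu> (\<lambda>x. exp (h * x))" for h
  proof (rule integrable_const_bound[where B="exp (\<bar>h\<bar> * K)"])
    show "AE x in \<mu>. norm (exp (h * x)) \<le> exp (\<bar>h\<bar> * K)"
      using bd
    proof eventually_elim
      case (elim x)
      have "h * x \<le> \<bar>h * x\<bar>" by simp
      also have "\<dots> \<le> \<bar>h\<bar> * K" unfolding abs_mult using elim by (intro mult_left_mono) auto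
      finally show ?case by simp
    qed
  qed auto
  define \<nu> where "\<nu> = density \<mu> (\<lambda>x. ennreal (exp (\<eta> * x) / m))"
  have S': "sets \<nu> = sets borel" by (simp add: \<nu>_def S)
  have "emeasure \<nu> (space \<nu>) = (\<integral>\<^sup>+x. ennreal (exp (\<eta> * x) / m) \<partial>\<mu>)"
    unfolding \<nu>_def by (subst emeasure_density) (auto intro!: nn_integral_cong)
  also have "\<dots> = ennreal (\<integral>x. exp (\<eta> * x) / m \<partial>\<mu>)"
    using iexp m by (intro nn_integral_eq_integral) auto
  also have "\<dots> = 1" using m mdef by simp
  finally have P: "prob_space \<nu>" by (rule prob_spaceI)
  interpret N: prob_space \<nu> by fact
  have bd': "AE x in \<nu>. \<bar>x\<bar> \<le> K"
    unfolding \<nu>_def using bd by (subst AE_density) auto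
  \<comment> \<open>Tilting translates the parameter: the generating function of
    \<open>\<nu>\<close> at \<open>h\<close> is that of \<open>\<mu>\<close> at
    \<open>\<eta> + h\<close> divided by \<open>m\<close>. A minimum at \<open>\<eta>\<close> thus
    becomes a minimum at 0.\<close>
  have "(\<integral>x. exp (h * x) \<partial>\<nu>) \<ge> 1" for h
  proof -
    have "(\<integral>x. exp (h * x) \<partial>\<nu>) = (\<integral>x. exp (\<eta> * x) / m * exp (h * x) \<partial>\<mu>)"
      unfolding \<nu>_def using m by (subst integral_density) auto
    also have "\<dots> = (\<integral>x. exp ((\<eta> + h) * x) / m \<partial>\<mu>)"
      by (intro Bochner_Integration.integral_cong) (auto simp: exp_add[symmetric] algebra_simps)
    also have "\<dots> \<ge> 1" using min[of "\<eta> + h"] m by simp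
    finally show ?thesis .
  qed
  then have z: "(\<integral>x. x \<partial>\<nu>) = 0"
    using P S' K bd' by (intro mean_zero_of_mgf_min) auto
  have i1: "integrable \<nu> (\<lambda>x. x)"
    by (rule N.integrable_const_bound[where B=K]) (use bd' S' in auto)
  have i2: "integrable \<nu> (\<lambda>x. x\<^sup>2)"
  proof (rule N.integrable_const_bound[where B="K\<^sup>2"])
    show "AE x in \<nu>. norm (x\<^sup>2) \<le> K\<^sup>2"
      using bd' by eventually_elim (use K in \<open>simp add: abs_le_square_iff[symmetric]\<close>)
  qed (use S' in auto)
  from walk_concentration[OF P S' i2 i1 z \<delta>] show ?thesis
  proof eventually_elim
    case (elim n)
    let ?I = "indicator {u. \<bar>u\<bar> < n * \<delta>} :: real \<Rightarrow> ennreal"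
    have "ennreal ((m * exp (- \<bar>\<eta>\<bar> * \<delta>)) ^ n / 2)
        = ennreal (m ^ n) * (ennreal (exp (- \<bar>\<eta>\<bar> * (n * \<delta>))) * ennreal (1/2))"
      using m by (simp add: ennreal_mult[symmetric] power_mult_distrib exp_of_nat_mult[symmetric] mult_ac
          del: ennreal_half)
    also have "\<dots> \<le> ennreal (m ^ n) * (ennreal (exp (- \<bar>\<eta>\<bar> * (n * \<delta>))) * (walk_step \<nu> ^^ n) ?I 0)"
      using elim by (intro mult_left_mono) auto
    also have "ennreal (exp (- \<bar>\<eta>\<bar> * (n * \<delta>))) * (walk_step \<nu> ^^ n) ?I 0
        = (walk_step \<nu> ^^ n) (\<lambda>u. ennreal (exp (- \<bar>\<eta>\<bar> * (n * \<delta>))) * ?I u) 0"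
      by (rule walk_cmult[symmetric]) (auto simp: S' intro: prob_space_imp_sigma_finite P)
    also have "\<dots> \<le> (walk_step \<nu> ^^ n) (\<lambda>u. ennreal (exp (- \<eta> * u)) * ?I u) 0"
    proof (rule walk_mono)
      fix s :: real
      have "- \<bar>\<eta>\<bar> * (n * \<delta>) \<le> - \<eta> * s" if "\<bar>s\<bar> < n * \<delta>"
      proof -
        have "\<eta> * s \<le> \<bar>\<eta>\<bar> * \<bar>s\<bar>" by (metis abs_ge_self abs_mult)
        also have "\<dots> \<le> \<bar>\<eta>\<bar> * (n * \<delta>)" using that by (intro mult_left_mono) auto
        finally show ?thesis by simp
      qed
      then show "ennreal (exp (- \<bar>\<eta>\<bar> * (n * \<delta>))) * ?I s \<le> ennreal (exp (- \<eta> * s)) * ?I s"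
        by (auto split: split_indicator intro!: ennreal_leI)
    qed
    also have "ennreal (m ^ n) * \<dots> = (walk_step \<mu> ^^ n) ?I 0"
      using walk_exponential_tilt[of \<mu> ?I m \<eta> n 0] m N.sigma_finite_measure_axioms
      by (simp add: S sigma_finite_measure_axioms \<nu>_def[symmetric])
    finally show ?case by (simp add: mult_left_mono)
  qed
qed

text \<open>Left unnormalised so that it increases with \<open>K\<close>: generating functions are
  then monotone in \<open>K\<close>, and walk expectations stay below those of
  \<open>\<mu>\<close>.\<close>

definition truncated :: "real measure \<Rightarrow> real \<Rightarrow> real measure" where
  "truncated \<mu> K = density \<mu> (indicator {-K..K})"

section \<open>Generating functions of truncated laws, and Cramer's lower bound\<close>

context
  fixes \<mu> :: "real measure"
  assumes fin: "finite_measure \<mu>" and S[measurable_cong]: "sets \<mu> = sets borel"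
begin

interpretation finite_measure \<mu> by (rule fin)

lemma sets_truncated [measurable_cong]: "sets (truncated \<mu> K) = sets borel"
  by (simp add: truncated_def S)

lemma finite_measure_truncated: "finite_measure (truncated \<mu> K)"
proof
  have "emeasure (truncated \<mu> K) (space (truncated \<mu> K)) = (\<integral>\<^sup>+x. indicator {-K..K} x \<partial>\<mu>)"
    unfolding truncated_def by (subst emeasure_density) (auto intro!: nn_integral_cong)
  also have "\<dots> = emeasure \<mu> {-K..K}" by (rule nn_integral_indicator) (simp add: S)
  finally show "emeasure (truncated \<mu> K) (space (truncated \<mu> K)) \<noteq> \<infinity>" by simp
qed

lemma AE_truncated: "AE x in truncated \<mu> K. \<bar>x\<bar> \<le> K"
  unfolding truncated_def by (subst AE_density) (auto split: split_indicator)

lemma nn_integral_truncated: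
  "f \<in> borel_measurable borel \<Longrightarrow>
    (\<integral>\<^sup>+x. f x \<partial>truncated \<mu> K) = (\<integral>\<^sup>+x. indicator {-K..K} x * f x \<partial>\<mu>)"
  unfolding truncated_def by (subst nn_integral_density) auto

lemma AE_exp_truncated: "AE x in truncated \<mu> K. norm (exp (t * x)) \<le> exp (\<bar>t\<bar> * K)"
  using AE_truncated
proof eventually_elim
  case (elim x)
  have "t * x \<le> \<bar>t * x\<bar>" by simp
  also have "\<dots> \<le> \<bar>t\<bar> * K" unfolding abs_mult using elim by (intro mult_left_mono) auto
  finally show ?case by simp
qed

lemma integrable_exp_truncated: "integrable (truncated \<mu> K) (\<lambda>x. exp (t * x))"
proof -
  interpret T: finite_measure "truncated \<mu> K" by (rule finite_measure_truncated)
  show ?thesis by (rule T.integrable_const_bound[OF AE_exp_truncated]) auto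
qed

lemma ennreal_mgf_truncated:
  "ennreal (\<integral>x. exp (t * x) \<partial>truncated \<mu> K)
    = (\<integral>\<^sup>+x. indicator {-K..K} x * ennreal (exp (t * x)) \<partial>\<mu>)"
  by (subst nn_integral_eq_integral[symmetric])
     (auto simp: integrable_exp_truncated nn_integral_truncated)

lemma mgf_truncated_mono:
  assumes "K \<le> K'"
  shows "(\<integral>x. exp (t * x) \<partial>truncated \<mu> K) \<le> (\<integral>x. exp (t * x) \<partial>truncated \<mu> K')"
proof -
  have "ennreal (\<integral>x. exp (t * x) \<partial>truncated \<mu> K) \<le> ennreal (\<integral>x. exp (t * x) \<partial>truncated \<mu> K')"
    unfolding ennreal_mgf_truncated
    using assms by (intro nn_integral_mono) (auto split: split_indicator)
  then show ?thesis by (simp add: ennreal_le_iff)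
qed

lemma continuous_on_mgf_truncated: "continuous_on UNIV (\<lambda>t. \<integral>x. exp (t * x) \<partial>truncated \<mu> K)"
proof -
  interpret T: finite_measure "truncated \<mu> K" by (rule finite_measure_truncated)
  show ?thesis
    unfolding continuous_on_sequentially
  proof (intro allI ballI impI, unfold o_def, elim conjE)
    fix u :: "nat \<Rightarrow> real" and t assume u: "u \<longlonglongrightarrow> t"
    then obtain B where B: "B > 0" "\<And>n. norm (u n) \<le> B"
      using convergent_imp_Bseq[OF convergentI[OF u]] unfolding Bseq_def by auto
    \<comment> \<open>A convergent sequence of parameters is bounded by some \<open>B\<close>, which
      yields a constant dominating function; the absolute value covers negative
      \<open>K\<close>.\<close>
    show "(\<lambda>n. \<integral>x. exp (u n * x) \<partial>truncated \<mu> K) \<longlonglongrightarrow> (\<integral>x. exp (t * x) \<partial>truncated \<mu> K)"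
    proof (rule integral_dominated_convergence[where w="\<lambda>_. exp (B * \<bar>K\<bar>)"])
      show "AE x in truncated \<mu> K. (\<lambda>n. exp (u n * x)) \<longlonglongrightarrow> exp (t * x)"
        using u by (auto intro!: tendsto_intros)
      fix n
      show "AE x in truncated \<mu> K. norm (exp (u n * x)) \<le> exp (B * \<bar>K\<bar>)"
        using AE_exp_truncated[of "u n" K]
      proof eventually_elim
        case (elim x)
        have "\<bar>u n\<bar> * K \<le> B * \<bar>K\<bar>"
          using B(2)[of n] by (intro order_trans[OF mult_left_mono[of K "\<bar>K\<bar>"] mult_right_mono]) auto
        then show ?case using elim by (auto intro: order_trans)
      qed
    qed auto
  qed
qed

text \<open>Monotone convergence in \<open>K\<close>. The left-hand side is an extended nonnegative
  integral because its finiteness is part of the conclusion.\<close>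

lemma nn_mgf_le_of_truncated:
  fixes N :: nat
  assumes "\<And>K::nat. K \<ge> N \<Longrightarrow> (\<integral>x. exp (t * x) \<partial>truncated \<mu> K) \<le> c"
  shows "(\<integral>\<^sup>+x. ennreal (exp (t * x)) \<partial>\<mu>) \<le> ennreal c"
proof -
  have "(\<integral>\<^sup>+x. ennreal (exp (t * x)) \<partial>\<mu>)
      = (\<integral>\<^sup>+x. (SUP K::nat. indicator {-real K..real K} x * ennreal (exp (t * x))) \<partial>\<mu>)"
  proof (intro nn_integral_cong antisym)
    fix x :: real
    obtain K :: nat where "\<bar>x\<bar> \<le> K" using real_arch_simple by blast
    then show "ennreal (exp (t * x)) \<le> (SUP K::nat. indicator {-real K..real K} x * ennreal (exp (t * x)))"
      by (intro SUP_upper2[of K]) (auto split: split_indicator)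
  qed (auto intro!: SUP_least split: split_indicator)
  also have "\<dots> = (SUP K::nat. \<integral>\<^sup>+x. indicator {-real K..real K} x * ennreal (exp (t * x)) \<partial>\<mu>)"
    by (rule nn_integral_monotone_convergence_SUP)
       (auto intro!: incseq_SucI le_funI split: split_indicator)
  also have "\<dots> \<le> ennreal c"
  proof (rule SUP_least)
    fix K :: nat
    have "(\<integral>x. exp (t * x) \<partial>truncated \<mu> K) \<le> (\<integral>x. exp (t * x) \<partial>truncated \<mu> (max K N))"
      by (rule mgf_truncated_mono) simp
    also have "\<dots> \<le> c" by (rule assms) simp
    finally show "(\<integral>\<^sup>+x. indicator {-real K..real K} x * ennreal (exp (t * x)) \<partial>\<mu>) \<le> ennreal c"
      unfolding ennreal_mgf_truncated[symmetric] by (rule ennreal_leI)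
  qed
  finally show ?thesis .
qed

text \<open>The factor \<open>s\<close> is a sign, so that both directions are handled at once. Some
  bounded set on which \<open>s * x\<close> stays above \<open>1 / N\<close> has positive mass
  \<open>p\<close>, and this mass alone forces exponential growth. It survives every truncation at
  \<open>K \<ge> N\<close>, which makes the estimate uniform in \<open>K\<close>.\<close>

lemma mgf_truncated_coercive:
  fixes s :: real
  assumes s: "s * s = 1" and pos: "emeasure \<mu> {x. 0 < s * x} \<noteq> 0"
  shows "\<exists>N::nat. N > 0 \<and> (\<exists>p>0. \<forall>K\<ge>real N. \<forall>t. 0 \<le> s * t \<longrightarrow>
      p * exp (s * t / N) \<le> (\<integral>x. exp (t * x) \<partial>truncated \<mu> K))"
proof -
  define A where "A n = {x::real. 1 / real (Suc n) \<le> s * x \<and> \<bar>x\<bar> \<le> real (Suc n)}" for n :: nat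
  have [measurable]: "A n \<in> sets borel" for n unfolding A_def by measurable
  have "{x. 0 < s * x} \<subseteq> (\<Union>n. A n)"
  proof
    fix x assume "x \<in> {x. 0 < s * x}"
    then have x: "0 < s * x" by simp
    obtain n where n: "max (1 / (s * x)) \<bar>x\<bar> < real n" using reals_Archimedean2 by blast
    then have "1 / (s * x) < real (Suc n)" "\<bar>x\<bar> \<le> real (Suc n)" by auto
    then have "x \<in> A n" using x by (simp add: A_def field_simps)
    then show "x \<in> (\<Union>n. A n)" by blast
  qed
  then have "\<not> (\<forall>n. A n \<in> null_sets \<mu>)"
    using pos null_sets_UN[of A \<mu>] null_sets_subset[of "\<Union>n. A n" \<mu> "{x. 0 < s * x}"]
    by (auto simp: S null_sets_def)
  then obtain n where n: "emeasure \<mu> (A n) \<noteq> 0" by (auto simp: null_sets_def S)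
  define p where "p = measure \<mu> (A n)"
  have p: "p > 0" using n by (simp add: p_def emeasure_eq_measure zero_less_measure_iff)
  have "p * exp (s * t / Suc n) \<le> (\<integral>x. exp (t * x) \<partial>truncated \<mu> K)"
    if "K \<ge> Suc n" "0 \<le> s * t" for K t :: real
  proof -
    have "ennreal (p * exp (s * t / Suc n)) = (\<integral>\<^sup>+x. ennreal (exp (s * t / Suc n)) * indicator (A n) x \<partial>\<mu>)"
      by (subst nn_integral_cmult_indicator)
         (auto simp: S p_def emeasure_eq_measure ennreal_mult mult.commute)
    also have "\<dots> \<le> (\<integral>\<^sup>+x. indicator {-K..K} x * ennreal (exp (t * x)) \<partial>\<mu>)"
    proof (intro nn_integral_mono)
      fix x
      have "s * t / Suc n \<le> t * x" if "x \<in> A n"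
      proof -
        have "s * t * (1 / Suc n) \<le> s * t * (s * x)"
          using that \<open>0 \<le> s * t\<close> by (intro mult_left_mono) (auto simp: A_def)
        also have "\<dots> = (s * s) * (t * x)" by (simp only: mult_ac)
        finally show ?thesis using s by simp
      qed
      moreover have "x \<in> {-K..K}" if "x \<in> A n" using that \<open>K \<ge> Suc n\<close> by (auto simp: A_def)
      ultimately show "ennreal (exp (s * t / Suc n)) * indicator (A n) x
          \<le> indicator {-K..K} x * ennreal (exp (t * x))"
        by (auto split: split_indicator intro!: ennreal_leI)
    qed
    also have "\<dots> = ennreal (\<integral>x. exp (t * x) \<partial>truncated \<mu> K)" by (rule ennreal_mgf_truncated[symmetric])
    finally show ?thesis by (simp add: ennreal_le_iff)
  qed
  then show ?thesis using p by (intro exI[of _ "Suc n"]) auto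
qed

text \<open>Mass on both sides makes the truncated generating functions coercive, so each attains
  its minimum once \<open>K\<close> is large. For some such \<open>K\<close> the minimum still
  exceeds \<open>c'\<close>, and the bounded case applies to that truncation.\<close>

lemma cramer_lower_two_sided:
  fixes \<delta> :: real
  assumes pos: "emeasure \<mu> {x. 0 < x} \<noteq> 0" and neg: "emeasure \<mu> {x. x < 0} \<noteq> 0"
    and M: "\<And>t. ennreal c \<le> (\<integral>\<^sup>+x. ennreal (exp (t * x)) \<partial>\<mu>)"
    and c: "0 < c'" "c' < c" and \<delta>: "\<delta> > 0"
  shows "eventually (\<lambda>n. ennreal (c' ^ n / 2)
      \<le> (walk_step \<mu> ^^ n) (indicator {u. \<bar>u\<bar> < n * \<delta>}) 0) sequentially"
proof -
  define m where "m K t = (\<integral>x. exp (t * x) \<partial>truncated \<mu> K)" for K t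
  have cont: "continuous_on UNIV (m K)" for K
    unfolding m_def[abs_def] by (rule continuous_on_mgf_truncated)
  obtain N1 :: nat and p1 where 1: "N1 > 0" "p1 > 0" "\<And>K t. K \<ge> real N1 \<Longrightarrow> 0 \<le> t \<Longrightarrow> p1 * exp (t / N1) \<le> m K t"
    using mgf_truncated_coercive[of 1] pos unfolding m_def by auto
  obtain N2 :: nat and p2 where 2: "N2 > 0" "p2 > 0" "\<And>K t. K \<ge> real N2 \<Longrightarrow> t \<le> 0 \<Longrightarrow> p2 * exp (- t / N2) \<le> m K t"
    using mgf_truncated_coercive[of "-1"] neg unfolding m_def by auto
  define N where "N = max N1 N2"
  have cpt: "compact {t. m (real K) t \<le> C}" if K: "K \<ge> N" for K C
  proof -
    \<comment> \<open>Boundedness of the sublevel set needs only linear growth, so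
      \<open>exp y\<close> is weakened to \<open>y\<close>.\<close>
    have "t \<le> N1 * (C / p1) \<or> t \<le> 0" "- t \<le> N2 * (C / p2) \<or> - t \<le> 0" if "m K t \<le> C" for t
    proof -
      have "t \<le> N1 * (C / p1)" if t: "t \<ge> 0"
      proof -
        have "p1 * (t / N1) \<le> p1 * exp (t / N1)"
          using 1(2) exp_ge_add_one_self[of "t / N1"] by (intro mult_left_mono) linarith+
        also have "\<dots> \<le> C" using 1(3)[of K t] t K \<open>m K t \<le> C\<close> by (auto simp: N_def)
        finally show ?thesis using 1 by (simp add: field_simps)
      qed
      then show "t \<le> N1 * (C / p1) \<or> t \<le> 0" by linarith
      have "- t \<le> N2 * (C / p2)" if t: "t \<le> 0"
      proof -
        have "p2 * (- t / N2) \<le> p2 * exp (- t / N2)"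
          using 2(2) exp_ge_add_one_self[of "- t / N2"] by (intro mult_left_mono) linarith+
        also have "\<dots> \<le> C" using 2(3)[of K t] t K \<open>m K t \<le> C\<close> by (auto simp: N_def)
        finally show ?thesis using 2 by (simp add: field_simps)
      qed
      then show "- t \<le> N2 * (C / p2) \<or> - t \<le> 0" by linarith
    qed
    then have "{t. m K t \<le> C} \<subseteq> {- max 0 (N2 * (C / p2)) .. max 0 (N1 * (C / p1))}"
      by (auto simp: max_def) (smt (verit))+
    then have "bounded {t. m K t \<le> C}" using bounded_closed_interval bounded_subset by blast
    moreover have "closed {t. m K t \<le> C}"
      using cont[of "real K"] by (intro closed_Collect_le) auto
    ultimately show ?thesis by (simp add: compact_eq_bounded_closed)
  qed
  obtain K where K: "K \<ge> N" "\<And>t. m (real K) t > c'"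
  proof (rule ccontr)
    assume "\<not> thesis"
    then have ne: "\<And>K. K \<ge> N \<Longrightarrow> {t. m (real K) t \<le> c'} \<noteq> {}"
      using that by (force simp: not_less)
    \<comment> \<open>If every truncation dipped to \<open>c'\<close> somewhere, these compact sets
      would decrease to a nonempty set. At a common point \<open>t\<close> the full generating
      function would be at most \<open>c'\<close>, below its lower bound \<open>c\<close>.\<close>
    have "(\<Inter>k. {t. m (real (N + k)) t \<le> c'}) \<noteq> {}"
    proof (rule compact_nest)
      fix i j :: nat assume "i \<le> j"
      then have "m (real (N + i)) t \<le> m (real (N + j)) t" for t
        unfolding m_def by (intro mgf_truncated_mono) simp
      then show "{t. m (real (N + j)) t \<le> c'} \<subseteq> {t. m (real (N + i)) t \<le> c'}"
        by (auto intro: order_trans)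
    next
      fix k :: nat
      show "compact {t. m (real (N + k)) t \<le> c'}" "{t. m (real (N + k)) t \<le> c'} \<noteq> {}"
        by (rule cpt, simp) (rule ne, simp)
    qed
    then obtain t where t: "\<And>k. m (real (N + k)) t \<le> c'" by auto
    have "(\<integral>\<^sup>+x. ennreal (exp (t * x)) \<partial>\<mu>) \<le> ennreal c'"
    proof (rule nn_mgf_le_of_truncated)
      fix K :: nat assume "K \<ge> N"
      then show "(\<integral>x. exp (t * x) \<partial>truncated \<mu> K) \<le> c'" using t[of "K - N"] by (simp add: m_def)
    qed
    then have "ennreal c \<le> ennreal c'" using M[of t] by (rule order_trans[rotated])
    then show False using c by (simp add: ennreal_le_iff)
  qed
  \<comment> \<open>Compact, and nonempty because it contains 0; outside it the values exceed the
    value at 0, so a minimiser on it is global.\<close>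
  let ?C = "{t. m (real K) t \<le> m (real K) 0}"
  obtain \<eta> where \<eta>: "\<eta> \<in> ?C" "\<And>t. t \<in> ?C \<Longrightarrow> m K \<eta> \<le> m K t"
    using continuous_attains_inf[of ?C "m K"] cpt[OF K(1)] continuous_on_subset[OF cont, of ?C K] by auto
  have min: "m K \<eta> \<le> m K t" for t
    using \<eta>(2)[of t] \<eta>(1) by (cases "t \<in> ?C") auto
  have mc: "m K \<eta> > c'" by (rule K)
  \<comment> \<open>The window is shrunk until the cost
    \<open>exp (\<bar>\<eta>\<bar> * \<delta>')\<close> per step fits into the gap between
    \<open>c'\<close> and the minimum. The summand 1 avoids division by zero at
    \<open>\<eta> = 0\<close>.\<close>
  define \<delta>' where "\<delta>' = min \<delta> (ln (m K \<eta> / c') / (\<bar>\<eta>\<bar> + 1))"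
  have lnpos: "ln (m K \<eta> / c') > 0" using mc c by (simp add: ln_gt_zero)
  then have \<delta>': "\<delta>' > 0" "\<delta>' \<le> \<delta>" using \<delta> by (auto simp: \<delta>'_def intro!: divide_pos_pos)
  have "\<bar>\<eta>\<bar> * \<delta>' \<le> ln (m K \<eta> / c')"
  proof -
    have "\<bar>\<eta>\<bar> * \<delta>' \<le> (\<bar>\<eta>\<bar> + 1) * \<delta>'" using \<delta>' by (simp add: algebra_simps)
    also have "\<dots> \<le> (\<bar>\<eta>\<bar> + 1) * (ln (m K \<eta> / c') / (\<bar>\<eta>\<bar> + 1))"
      by (intro mult_left_mono) (auto simp: \<delta>'_def)
    also have "\<dots> = ln (m K \<eta> / c')" by (simp add: add_nonneg_eq_0_iff)
    finally show ?thesis .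
  qed
  then have "exp (\<bar>\<eta>\<bar> * \<delta>') \<le> m K \<eta> / c'" using mc c by (subst (asm) ln_ge_iff) auto
  then have base: "c' \<le> m K \<eta> * exp (- \<bar>\<eta>\<bar> * \<delta>')"
    using c by (simp add: exp_minus field_simps)
  have "K > 0" using K(1) 1(1) by (auto simp: N_def)
  then have "eventually (\<lambda>n. ennreal ((m K \<eta> * exp (- \<bar>\<eta>\<bar> * \<delta>')) ^ n / 2)
      \<le> (walk_step (truncated \<mu> K) ^^ n) (indicator {u. \<bar>u\<bar> < n * \<delta>'}) 0) sequentially"
    using mc c min \<delta>' unfolding m_def
    by (intro walk_lower_bound_bounded[where K=K] finite_measure_truncated sets_truncated AE_truncated) auto
  then show ?thesis
  proof eventually_elim
    case (elim n)
    have "ennreal (c' ^ n / 2) \<le> ennreal ((m K \<eta> * exp (- \<bar>\<eta>\<bar> * \<delta>')) ^ n / 2)"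
      using base c by (intro ennreal_leI divide_right_mono power_mono) auto
    also note elim
    also have "(walk_step (truncated \<mu> K) ^^ n) (indicator {u. \<bar>u\<bar> < n * \<delta>'}) 0
        \<le> (walk_step \<mu> ^^ n) (indicator {u. \<bar>u\<bar> < n * \<delta>'}) 0"
      unfolding truncated_def
      by (rule walk_density_indicator_le) (auto simp: S sigma_finite_measure_axioms)
    also have "\<dots> \<le> (walk_step \<mu> ^^ n) (indicator {u. \<bar>u\<bar> < n * \<delta>}) 0"
    proof (rule walk_mono)
      fix s :: real
      have "n * \<delta>' \<le> n * \<delta>" using \<delta>' by (intro mult_left_mono) auto
      then show "indicator {u. \<bar>u\<bar> < n * \<delta>'} s \<le> (indicator {u. \<bar>u\<bar> < n * \<delta>} s :: ennreal)"
        by (auto split: split_indicator)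
    qed
    finally show ?case .
  qed
qed

text \<open>When the law lives on one side of \<open>0\<close>, letting the parameter tend to infinity on the other
  side leaves only the atom at \<open>0\<close>, and the walk can stay at \<open>0\<close>.\<close>

lemma cramer_lower_one_sided:
  fixes s \<delta> :: real
  assumes s: "s * s = 1" and null: "emeasure \<mu> {x. 0 < s * x} = 0"
    and M: "\<And>t. ennreal c \<le> (\<integral>\<^sup>+x. ennreal (exp (t * x)) \<partial>\<mu>)"
    and c: "0 < c" and \<delta>: "\<delta> > 0"
  shows "eventually (\<lambda>n. ennreal (c ^ n)
      \<le> (walk_step \<mu> ^^ n) (indicator {u. \<bar>u\<bar> < n * \<delta>}) 0) sequentially"
proof -
  have ae: "AE x in \<mu>. s * x \<le> 0"
    by (rule AE_I[where N="{x. 0 < s * x}"]) (use null in \<open>auto simp: S\<close>)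
  have int: "integrable \<mu> (\<lambda>x. exp (s * real k * x))" for k
  proof (rule integrable_const_bound[where B=1])
    show "AE x in \<mu>. norm (exp (s * real k * x)) \<le> 1"
      using ae
    proof eventually_elim
      case (elim x)
      have "real k * (s * x) \<le> 0" using elim by (simp add: mult_nonneg_nonpos)
      then show ?case by (simp add: mult_ac)
    qed
  qed auto
  have "(\<lambda>k. \<integral>x. exp (s * real k * x) \<partial>\<mu>) \<longlonglongrightarrow> (\<integral>x. indicator {0} x \<partial>\<mu>)"
  proof (rule integral_dominated_convergence[where w="\<lambda>_. 1"])
    show "AE x in \<mu>. (\<lambda>k. exp (s * real k * x)) \<longlonglongrightarrow> indicator {0} x"
      using ae
    proof eventually_elim
      case (elim x)
      show ?case
      proof (cases "x = 0")
        case False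
        then have "s * x < 0" using elim s by (auto simp: less_le)
        then have "(\<lambda>k. exp (s * x) ^ k) \<longlonglongrightarrow> 0" by (intro LIMSEQ_realpow_zero) auto
        moreover have "exp (s * x) ^ k = exp (s * real k * x)" for k
          by (simp add: exp_of_nat_mult[symmetric] mult_ac)
        ultimately show ?thesis using False by simp
      qed simp
    qed
    fix k show "AE x in \<mu>. norm (exp (s * real k * x)) \<le> 1"
      using ae
    proof eventually_elim
      case (elim x)
      have "real k * (s * x) \<le> 0" using elim by (simp add: mult_nonneg_nonpos)
      then show ?case by (simp add: mult_ac)
    qed
  qed (auto simp: S)
  moreover have "c \<le> (\<integral>x. exp (s * real k * x) \<partial>\<mu>)" for k
    using M[of "s * real k"] int[of k] by (subst (asm) nn_integral_eq_integral) (auto simp: ennreal_le_iff)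
  ultimately have "c \<le> (\<integral>x. indicator {0} x \<partial>\<mu>)"
    by (intro LIMSEQ_le_const) auto
  then have atom: "ennreal c \<le> emeasure \<mu> {0}"
    by (simp add: S emeasure_eq_measure ennreal_leI)
  have stay: "ennreal (c ^ n) \<le> (walk_step \<mu> ^^ n) (indicator {0}) 0" for n
  proof (induction n)
    case (Suc n)
    have [measurable]: "(walk_step \<mu> ^^ n) (indicator {0}) \<in> borel_measurable borel"
      by (rule walk_measurable) (auto simp: S sigma_finite_measure_axioms)
    have "ennreal (c ^ Suc n) \<le> (walk_step \<mu> ^^ n) (indicator {0}) 0 * emeasure \<mu> {0}"
      using mult_mono[OF Suc atom] c by (simp add: ennreal_mult[symmetric] mult.commute)
    also have "\<dots> = (\<integral>\<^sup>+x. (walk_step \<mu> ^^ n) (indicator {0}) 0 * indicator {0} x \<partial>\<mu>)"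
      by (rule nn_integral_cmult_indicator[symmetric]) (simp add: S)
    also have "\<dots> \<le> (walk_step \<mu> ^^ Suc n) (indicator {0}) 0"
      unfolding walk_Suc by (intro nn_integral_mono) (auto split: split_indicator)
    finally show ?case .
  qed simp
  \<comment> \<open>For \<open>n = 0\<close> the window is empty, so the walk resting at 0 is inside
    it only from \<open>n = 1\<close> on.\<close>
  show ?thesis
    using eventually_gt_at_top[of 0]
  proof eventually_elim
    case (elim n)
    have "(walk_step \<mu> ^^ n) (indicator {0}) 0 \<le> (walk_step \<mu> ^^ n) (indicator {u. \<bar>u\<bar> < n * \<delta>}) 0"
      using elim \<delta> by (intro walk_mono) (auto split: split_indicator)
    with stay[of n] show ?case by (rule order_trans)
  qed
qed

lemma cramer_lower:
  fixes \<delta> :: real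
  assumes M: "\<And>t. ennreal c \<le> (\<integral>\<^sup>+x. ennreal (exp (t * x)) \<partial>\<mu>)"
    and c: "0 < c'" "c' < c" and \<delta>: "\<delta> > 0"
  shows "eventually (\<lambda>n. ennreal (c' ^ n / 2)
      \<le> (walk_step \<mu> ^^ n) (indicator {u. \<bar>u\<bar> < n * \<delta>}) 0) sequentially"
proof (cases "emeasure \<mu> {x. 0 < x} \<noteq> 0 \<and> emeasure \<mu> {x. x < 0} \<noteq> 0")
  case True
  then show ?thesis using assms by (intro cramer_lower_two_sided) auto
next
  case False
  then have "emeasure \<mu> {x. 0 < 1 * x} = 0 \<or> emeasure \<mu> {x. 0 < -1 * x} = 0" by auto
  then have "eventually (\<lambda>n. ennreal (c ^ n)
      \<le> (walk_step \<mu> ^^ n) (indicator {u. \<bar>u\<bar> < n * \<delta>}) 0) sequentially"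
    using cramer_lower_one_sided[of 1 c \<delta>] cramer_lower_one_sided[of "-1" c \<delta>] M c \<delta> by auto
  then show ?thesis
  proof eventually_elim
    case (elim n)
    have "c' ^ n / 2 \<le> c' ^ n" using c by simp
    also have "\<dots> \<le> c ^ n" using c by (intro power_mono) auto
    finally show ?case using elim by (auto intro: order_trans[OF ennreal_leI])
  qed
qed

end

subsection \<open>Independence\<close>

context prob_space
begin

text \<open>Indexing both sequences by a disjoint sum turns them into one independent family, which
  can then be regrouped into the past of both arms and a single current outcome. A finite
  intersection of events splits into a cylinder event for each sequence; these are independent, and
  each factorises.\<close>

lemma indep_vars_case_sum:
  assumes X: "indep_vars (\<lambda>_. borel) X I" and Y: "indep_vars (\<lambda>_. borel) Y J"
    and XY: "indep_var (\<Pi>\<^sub>M i\<in>I. borel) (\<lambda>\<omega>. \<lambda>i\<in>I. X i \<omega>) (\<Pi>\<^sub>M i\<in>J. borel) (\<lambda>\<omega>. \<lambda>i\<in>J. Y i \<omega>)"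
  shows "indep_vars (\<lambda>_. borel :: real measure) (case_sum X Y) (I <+> J)"
  unfolding indep_vars_def2
proof (intro conjI ballI indep_setsI)
  have rv: "\<And>i. i \<in> I \<Longrightarrow> random_variable borel (X i)" "\<And>j. j \<in> J \<Longrightarrow> random_variable borel (Y j)"
    using X Y by (auto simp: indep_vars_def)
  show rvs: "random_variable borel (case_sum X Y i)" if "i \<in> I <+> J" for i
    using that rv by auto
  show "{case_sum X Y i -` A \<inter> space M |A. A \<in> sets borel} \<subseteq> events" if "i \<in> I <+> J" for i
    using measurable_sets[OF rvs[OF that]] by auto
  fix A K
  assume K: "K \<noteq> {}" "K \<subseteq> I <+> J" "finite K"
    and "\<forall>k\<in>K. A k \<in> {case_sum X Y k -` A \<inter> space M |A. A \<in> sets borel}"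
  then obtain B where B: "\<And>k. k \<in> K \<Longrightarrow> B k \<in> sets borel"
      "\<And>k. k \<in> K \<Longrightarrow> A k = case_sum X Y k -` B k \<inter> space M"
    by (simp only: mem_Collect_eq) metis
  define KL where "KL = Inl -` K"
  define KR where "KR = Inr -` K"
  have fin: "finite KL" "finite KR" using K(3) by (auto simp: KL_def KR_def intro!: finite_vimageI)
  have sub: "KL \<subseteq> I" "KR \<subseteq> J" using K(2) by (auto simp: KL_def KR_def)
  have K_eq: "K = Inl ` KL \<union> Inr ` KR"
    using K(2) by (auto simp: KL_def KR_def image_iff)
  define EL where "EL = {f\<in>space (\<Pi>\<^sub>M i\<in>I. borel :: real measure). \<forall>i\<in>KL. f i \<in> B (Inl i)}"
  define ER where "ER = {f\<in>space (\<Pi>\<^sub>M i\<in>J. borel :: real measure). \<forall>i\<in>KR. f i \<in> B (Inr i)}"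
  have BL: "B (Inl i) \<in> sets borel" if "i \<in> KL" for i using that B(1) by (auto simp: KL_def)
  have BR: "B (Inr i) \<in> sets borel" if "i \<in> KR" for i using that B(1) by (auto simp: KR_def)
  have EL: "EL \<in> sets (\<Pi>\<^sub>M i\<in>I. borel)" unfolding EL_def
    using fin sub BL by (intro sets.sets_Collect_finite_All measurable_sets_Collect[OF measurable_component_singleton]) auto
  have ER: "ER \<in> sets (\<Pi>\<^sub>M i\<in>J. borel)" unfolding ER_def
    using fin sub BR by (intro sets.sets_Collect_finite_All measurable_sets_Collect[OF measurable_component_singleton]) auto
  let ?L = "{\<omega>\<in>space M. \<forall>i\<in>KL. X i \<omega> \<in> B (Inl i)}"
  let ?R = "{\<omega>\<in>space M. \<forall>i\<in>KR. Y i \<omega> \<in> B (Inr i)}"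
  have L: "(\<lambda>\<omega>. \<lambda>i\<in>I. X i \<omega>) -` EL \<inter> space M = ?L"
    using sub by (auto simp: EL_def space_PiM)
  have R: "(\<lambda>\<omega>. \<lambda>i\<in>J. Y i \<omega>) -` ER \<inter> space M = ?R"
    using sub by (auto simp: ER_def space_PiM)
  have "(\<Inter>k\<in>K. A k) = (\<lambda>x. (\<lambda>i\<in>I. X i x, \<lambda>i\<in>J. Y i x)) -` (EL \<times> ER) \<inter> space M"
  proof -
    have "(\<Inter>k\<in>K. A k) = {\<omega>\<in>space M. \<forall>k\<in>K. case_sum X Y k \<omega> \<in> B k}"
      using K(1) B(2) by auto
    also have "\<dots> = ?L \<inter> ?R"
      unfolding K_eq by (auto simp: ball_Un)
    also have "\<dots> = (\<lambda>x. (\<lambda>i\<in>I. X i x, \<lambda>i\<in>J. Y i x)) -` (EL \<times> ER) \<inter> space M"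
      using L R by blast
    finally show ?thesis .
  qed
  then have "prob (\<Inter>k\<in>K. A k) = prob ?L * prob ?R"
    using indep_varD[OF XY EL ER] L R by simp
  also have "prob ?L = (\<Prod>i\<in>KL. prob (A (Inl i)))"
  \<comment> \<open>The product rule \<open>indep_varsD\<close> asks for a nonempty index set; an
    empty one gives the whole space and the empty product.\<close>
  proof (cases "KL = {}")
    case False
    then have "?L = (\<Inter>i\<in>KL. X i -` B (Inl i) \<inter> space M)" by auto
    also have "prob \<dots> = (\<Prod>i\<in>KL. prob (X i -` B (Inl i) \<inter> space M))"
      using False fin sub BL by (intro indep_varsD[OF X]) auto
    also have "\<dots> = (\<Prod>i\<in>KL. prob (A (Inl i)))"
      by (intro prod.cong refl) (simp add: B(2) KL_def)
    finally show ?thesis .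
  qed (simp add: prob_space)
  also have "prob ?R = (\<Prod>i\<in>KR. prob (A (Inr i)))"
  proof (cases "KR = {}")
    case False
    then have "?R = (\<Inter>i\<in>KR. Y i -` B (Inr i) \<inter> space M)" by auto
    also have "prob \<dots> = (\<Prod>i\<in>KR. prob (Y i -` B (Inr i) \<inter> space M))"
      using False fin sub BR by (intro indep_varsD[OF Y]) auto
    also have "\<dots> = (\<Prod>i\<in>KR. prob (A (Inr i)))"
      by (intro prod.cong refl) (simp add: B(2) KR_def)
    finally show ?thesis .
  qed (simp add: prob_space)
  also have "(\<Prod>i\<in>KL. prob (A (Inl i))) * (\<Prod>i\<in>KR. prob (A (Inr i))) = (\<Prod>k\<in>K. prob (A k))"
    using fin by (subst K_eq, subst prod.union_disjoint) (auto simp: prod.reindex)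
  finally show "prob (\<Inter>k\<in>K. A k) = (\<Prod>k\<in>K. prob (A k))" .
qed

lemma indep_var_nn_integral_mult:
  assumes ind: "indep_var S X T Y"
    and f[measurable]: "f \<in> borel_measurable S" and g[measurable]: "g \<in> borel_measurable T"
  shows "(\<integral>\<^sup>+\<omega>. f (X \<omega>) * g (Y \<omega>) \<partial>M) = (\<integral>\<^sup>+\<omega>. f (X \<omega>) \<partial>M) * (\<integral>\<^sup>+\<omega>. g (Y \<omega>) \<partial>M)"
proof -
  have [measurable]: "random_variable S X" "random_variable T Y"
    using ind by (auto dest: indep_var_rv1 indep_var_rv2)
  interpret T: prob_space "distr M T Y" by (rule prob_space_distr) measurable
  have "(\<integral>\<^sup>+\<omega>. f (X \<omega>) * g (Y \<omega>) \<partial>M)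
      = (\<integral>\<^sup>+z. f (fst z) * g (snd z) \<partial>distr M (S \<Otimes>\<^sub>M T) (\<lambda>\<omega>. (X \<omega>, Y \<omega>)))"
    by (subst nn_integral_distr) auto
  also have "\<dots> = (\<integral>\<^sup>+z. f (fst z) * g (snd z) \<partial>(distr M S X \<Otimes>\<^sub>M distr M T Y))"
    using ind by (simp add: indep_var_distribution_eq)
  also have "\<dots> = (\<integral>\<^sup>+x. \<integral>\<^sup>+y. f x * g y \<partial>distr M T Y \<partial>distr M S X)"
    by (subst T.nn_integral_fst[symmetric]) auto
  also have "\<dots> = (\<integral>\<^sup>+x. f x * (\<integral>\<^sup>+y. g y \<partial>distr M T Y) \<partial>distr M S X)"
    by (simp add: nn_integral_cmult)
  also have "\<dots> = (\<integral>\<^sup>+\<omega>. f (X \<omega>) \<partial>M) * (\<integral>\<^sup>+\<omega>. g (Y \<omega>) \<partial>M)"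
    by (simp add: nn_integral_multc nn_integral_distr)
  finally show ?thesis .
qed

text \<open>Here \<open>f\<close> is only measurable with respect to the information in
  \<open>X\<close>. Comparing generated \<sigma>-algebras spares writing \<open>f\<close> as a
  function of \<open>X\<close>.\<close>

lemma indep_var_vimage_algebra_nn_integral_mult:
  fixes f :: "'a \<Rightarrow> ennreal"
  assumes ind: "indep_var S X T Y"
    and f: "f \<in> borel_measurable (vimage_algebra (space M) X S)"
    and g: "g \<in> borel_measurable T"
  shows "(\<integral>\<^sup>+\<omega>. f \<omega> * g (Y \<omega>) \<partial>M) = (\<integral>\<^sup>+\<omega>. f \<omega> \<partial>M) * (\<integral>\<^sup>+\<omega>. g (Y \<omega>) \<partial>M)"
proof -
  have X: "random_variable S X" and Y: "random_variable T Y"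
    using ind by (auto dest: indep_var_rv1 indep_var_rv2)
  let ?V = "vimage_algebra (space M) X S"
  let ?sX = "sigma_sets (space M) {X -` A \<inter> space M |A. A \<in> sets S}"
  let ?sY = "sigma_sets (space M) {Y -` A \<inter> space M |A. A \<in> sets T}"
  have V: "sets ?V = {X -` A \<inter> space M |A. A \<in> sets S}"
    using X by (intro sets_vimage_algebra2) (auto dest: measurable_space)
  have "sets ?V \<subseteq> events"
    unfolding V using measurable_sets[OF X] by auto
  then have f': "random_variable borel f"
    using f measurable_mono[of borel borel ?V M] by auto
  have gY: "random_variable borel (\<lambda>\<omega>. g (Y \<omega>))"
    using Y g by (rule measurable_compose)
  have "{f -` A \<inter> space M |A. A \<in> sets borel} \<subseteq> sets ?V"
    using measurable_sets[OF f] by auto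
  then have sub_X: "sigma_sets (space M) {f -` A \<inter> space M |A. A \<in> sets borel} \<subseteq> ?sX"
    unfolding V by (rule sigma_sets_mono')
  have sub_Y: "sigma_sets (space M) {(\<lambda>\<omega>. g (Y \<omega>)) -` A \<inter> space M |A. A \<in> sets borel} \<subseteq> ?sY"
  proof (rule sigma_sets_mono', safe)
    fix A :: "ennreal set" assume "A \<in> sets borel"
    then have "g -` A \<inter> space T \<in> sets T" using g by (rule measurable_sets[rotated])
    moreover have "(\<lambda>\<omega>. g (Y \<omega>)) -` A \<inter> space M = Y -` (g -` A \<inter> space T) \<inter> space M"
      using measurable_space[OF Y] by auto
    ultimately show "\<exists>B. (\<lambda>\<omega>. g (Y \<omega>)) -` A \<inter> space M = Y -` B \<inter> space M \<and> B \<in> sets T"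
      by blast
  qed
  have "indep_set ?sX ?sY" using ind by (simp add: indep_var_eq)
  then have "indep_set (sigma_sets (space M) {f -` A \<inter> space M |A. A \<in> sets borel})
      (sigma_sets (space M) {(\<lambda>\<omega>. g (Y \<omega>)) -` A \<inter> space M |A. A \<in> sets borel})"
    using sub_X sub_Y unfolding indep_sets2_eq by blast
  then have "indep_var borel f borel (\<lambda>\<omega>. g (Y \<omega>))"
    using f' gY by (simp add: indep_var_eq)
  from indep_var_nn_integral_mult[OF this, of "\<lambda>x. x" "\<lambda>x. x"] show ?thesis by simp
qed

text \<open>The bridge from random variables to the one-step operator: one summand is split off, and
  by independence its joint law with the remaining sum is a product, to which Tonelli's theorem
  applies. Only the number of summands matters, so the same formula serves any block of
  rounds.\<close>

lemma nn_integral_indep_sum: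
  assumes "finite I" and ind: "indep_vars (\<lambda>_. borel) X I"
    and law: "\<And>i. i \<in> I \<Longrightarrow> distr M borel (X i) = \<mu>" and f[measurable]: "f \<in> borel_measurable borel"
  shows "(\<integral>\<^sup>+\<omega>. f (s + (\<Sum>i\<in>I. X i \<omega>)) \<partial>M) = (walk_step \<mu> ^^ card I) f s"
  using assms(1) ind law
proof (induction I arbitrary: s rule: finite_induct)
  case empty
  then show ?case by (simp add: emeasure_space_1)
next
  case (insert i I)
  have rv: "random_variable borel (X j)" if "j \<in> insert i I" for j
    using insert.prems(1) that unfolding indep_vars_def by blast
  have ind_sum: "indep_var borel (X i) borel (\<lambda>\<omega>. \<Sum>i\<in>I. X i \<omega>)"
    by (intro indep_vars_sum insert)
  have rvX[measurable]: "random_variable borel (X i)" using rv by simp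
  have [measurable]: "random_variable borel (\<lambda>\<omega>. \<Sum>i\<in>I. X i \<omega>)"
    using rv by (intro borel_measurable_sum) auto
  interpret S: prob_space "distr M borel (\<lambda>\<omega>. \<Sum>i\<in>I. X i \<omega>)" by (rule prob_space_distr) measurable
  have "(\<integral>\<^sup>+\<omega>. f (s + (\<Sum>i\<in>insert i I. X i \<omega>)) \<partial>M) = (\<integral>\<^sup>+\<omega>. f (s + X i \<omega> + (\<Sum>i\<in>I. X i \<omega>)) \<partial>M)"
    using insert.hyps by (simp add: add.assoc)
  also have "\<dots> = (\<integral>\<^sup>+z. f (s + fst z + snd z)
      \<partial>distr M (borel \<Otimes>\<^sub>M borel) (\<lambda>\<omega>. (X i \<omega>, \<Sum>i\<in>I. X i \<omega>)))"
    by (subst nn_integral_distr) auto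
  also have "\<dots> = (\<integral>\<^sup>+z. f (s + fst z + snd z)
      \<partial>(distr M borel (X i) \<Otimes>\<^sub>M distr M borel (\<lambda>\<omega>. \<Sum>i\<in>I. X i \<omega>)))"
    using ind_sum by (simp add: indep_var_distribution_eq)
  also have "\<dots> = (\<integral>\<^sup>+x. \<integral>\<^sup>+y. f (s + x + y) \<partial>distr M borel (\<lambda>\<omega>. \<Sum>i\<in>I. X i \<omega>) \<partial>distr M borel (X i))"
    by (subst S.nn_integral_fst[symmetric]) auto
  also have "\<dots> = (\<integral>\<^sup>+x. (walk_step \<mu> ^^ card I) f (s + x) \<partial>distr M borel (X i))"
  proof (intro nn_integral_cong)
    fix x
    have "(\<integral>\<^sup>+y. f (s + x + y) \<partial>distr M borel (\<lambda>\<omega>. \<Sum>i\<in>I. X i \<omega>))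
        = (\<integral>\<^sup>+\<omega>. f (s + x + (\<Sum>i\<in>I. X i \<omega>)) \<partial>M)"
      by (subst nn_integral_distr) auto
    also have "\<dots> = (walk_step \<mu> ^^ card I) f (s + x)"
      using insert.prems by (intro insert.IH) (auto intro: indep_vars_subset)
    finally show "(\<integral>\<^sup>+y. f (s + x + y) \<partial>distr M borel (\<lambda>\<omega>. \<Sum>i\<in>I. X i \<omega>)) = (walk_step \<mu> ^^ card I) f (s + x)" .
  qed
  also have "\<dots> = (walk_step \<mu> ^^ card (insert i I)) f s"
    using insert.hyps insert.prems(2)[of i] by (simp add: walk_Suc del: funpow.simps)
  finally show ?case .
qed

lemma emeasure_centred_sum:
  fixes a :: real
  assumes "finite I" and ind: "indep_vars (\<lambda>_. borel) X I" and W[measurable]: "random_variable borel W"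
    and law: "\<And>i. i \<in> I \<Longrightarrow> distr M borel (X i) = distr M borel W" and A[measurable]: "A \<in> sets borel"
  shows "emeasure M {\<omega>\<in>space M. (\<Sum>i\<in>I. X i \<omega>) - card I * a \<in> A}
    = (walk_step (distr M borel (\<lambda>\<omega>. W \<omega> - a)) ^^ card I) (indicator A) 0"
proof -
  have rv: "random_variable borel (X j)" if "j \<in> I" for j
    using ind that unfolding indep_vars_def by blast
  have [measurable]: "random_variable borel (\<lambda>\<omega>. \<Sum>i\<in>I. X i \<omega>)"
    using rv by (intro borel_measurable_sum) auto
  have eq: "(\<Sum>i\<in>I. X i \<omega>) - card I * a = 0 + (\<Sum>i\<in>I. X i \<omega> - a)" for \<omega>
    by (simp add: sum_subtractf)
  have "emeasure M {\<omega>\<in>space M. (\<Sum>i\<in>I. X i \<omega>) - card I * a \<in> A}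
      = (\<integral>\<^sup>+\<omega>. indicator A (0 + (\<Sum>i\<in>I. X i \<omega> - a)) \<partial>M)"
  proof -
    let ?S = "{\<omega>\<in>space M. (\<Sum>i\<in>I. X i \<omega>) - card I * a \<in> A}"
    have "emeasure M ?S = (\<integral>\<^sup>+\<omega>. indicator ?S \<omega> \<partial>M)"
      by (rule nn_integral_indicator[symmetric]) measurable
    also have "\<dots> = (\<integral>\<^sup>+\<omega>. indicator A (0 + (\<Sum>i\<in>I. X i \<omega> - a)) \<partial>M)"
      unfolding eq[symmetric] by (intro nn_integral_cong) (auto split: split_indicator)
    finally show ?thesis .
  qed
  also have "\<dots> = (walk_step (distr M borel (\<lambda>\<omega>. W \<omega> - a)) ^^ card I) (indicator A) 0"
  proof (rule nn_integral_indep_sum)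
    show "indep_vars (\<lambda>_. borel) (\<lambda>i \<omega>. X i \<omega> - a) I"
      by (rule indep_vars_compose2[OF ind]) auto
    fix i assume i: "i \<in> I"
    have "distr M borel (\<lambda>\<omega>. X i \<omega> - a) = distr (distr M borel (X i)) borel (\<lambda>x. x - a)"
      using rv[OF i] by (subst distr_distr) (auto simp: o_def)
    also have "\<dots> = distr M borel (\<lambda>\<omega>. W \<omega> - a)"
      unfolding law[OF i] by (subst distr_distr) (auto simp: o_def)
    finally show "distr M borel (\<lambda>\<omega>. X i \<omega> - a) = distr M borel (\<lambda>\<omega>. W \<omega> - a)" .
  qed (use assms in auto)
  finally show ?thesis .
qed

end

subsection \<open>Exponential moments under adaptive sampling\<close>

text \<open>The information contained in both arms before round \<open>n\<close>; it is larger than the history of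
  the rewards, but still independent of what either arm yields in round \<open>n\<close>.\<close>

definition past ::
  "'a measure \<Rightarrow> (nat \<Rightarrow> 'a \<Rightarrow> real) \<Rightarrow> (nat \<Rightarrow> 'a \<Rightarrow> real) \<Rightarrow> nat \<Rightarrow> 'a measure" where
  "past M XL XR n = vimage_algebra (space M)
     (\<lambda>\<omega>. \<lambda>j\<in>{1..<n} <+> {1..<n}. case_sum XL XR j \<omega>) (\<Pi>\<^sub>M j\<in>{1..<n} <+> {1..<n}. borel)"

lemma space_past [simp]: "space (past M XL XR n) = space M"
  by (simp add: past_def)

lemma arm_measurable_past:
  assumes "1 \<le> i" "i < n"
  shows "XL i \<in> borel_measurable (past M XL XR n)" "XR i \<in> borel_measurable (past M XL XR n)"
proof -
  let ?J = "{1..<n} <+> {1..<n}"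
  let ?\<Phi> = "\<lambda>\<omega>. \<lambda>j\<in>?J. case_sum XL XR j \<omega>"
  have \<Phi>: "?\<Phi> \<in> measurable (past M XL XR n) (\<Pi>\<^sub>M j\<in>?J. borel)"
    unfolding past_def by (rule measurable_vimage_algebra1) (auto simp: space_PiM)
  have "(\<lambda>\<omega>. ?\<Phi> \<omega> j) \<in> borel_measurable (past M XL XR n)" if "j \<in> ?J" for j
    using measurable_compose[OF \<Phi> measurable_component_singleton[OF that]] .
  from this[of "Inl i"] this[of "Inr i"] InlI[of i "{1..<n}" "{1..<n}"] InrI[of i "{1..<n}" "{1..<n}"] assms
  show "XL i \<in> borel_measurable (past M XL XR n)" "XR i \<in> borel_measurable (past M XL XR n)"
    by auto
qed

lemma space_history [simp]: "space (history M XL XR \<theta> n) = space M"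
  by (simp add: history_def space_measure_of_conv)

lemma sets_history_subset_past:
  assumes "\<And>i. 1 \<le> i \<Longrightarrow> i \<le> k \<Longrightarrow> reward XL XR \<theta> i \<in> borel_measurable (past M XL XR n)"
  shows "sets (history M XL XR \<theta> k) \<subseteq> sets (past M XL XR n)"
proof -
  let ?G = "{reward XL XR \<theta> i -` B \<inter> space M | i B. i \<in> {1..k} \<and> B \<in> sets borel}"
  have "sets (history M XL XR \<theta> k) = sigma_sets (space M) ?G"
    unfolding history_def by (rule sets_measure_of) auto
  also have "\<dots> \<subseteq> sets (past M XL XR n)"
    using sets.sigma_sets_subset[of ?G "past M XL XR n"] measurable_sets[OF assms] by auto
  finally show ?thesis .
qed

text \<open>Choices and rewards are treated in one induction, since a choice depends on earlier
  rewards and a reward on the choice of its own round. The bounds differ on purpose: the choice of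
  round \<open>n\<close> is known from the past, its reward is not.\<close>

lemma strategy_measurable_past:
  assumes adm: "\<theta> \<in> admissible_strategies M XL XR"
  shows "1 \<le> i \<Longrightarrow> i \<le> n \<Longrightarrow> \<theta> i \<in> measurable (past M XL XR n) (count_space {1, 2})"
    and "1 \<le> i \<Longrightarrow> i < n \<Longrightarrow> reward XL XR \<theta> i \<in> borel_measurable (past M XL XR n)"
proof -
  have "(1 \<le> i \<longrightarrow> i \<le> n \<longrightarrow> \<theta> i \<in> measurable (past M XL XR n) (count_space {1, 2})) \<and>
    (1 \<le> i \<longrightarrow> i < n \<longrightarrow> reward XL XR \<theta> i \<in> borel_measurable (past M XL XR n))"
  proof (induction i rule: less_induct)
    case (less i)
    have \<theta>: "\<theta> i \<in> measurable (past M XL XR n) (count_space {1, 2})" if i: "1 \<le> i" "i \<le> n"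
    proof -
      have "sets (history M XL XR \<theta> (i - 1)) \<subseteq> sets (past M XL XR n)"
        using less i by (intro sets_history_subset_past) auto
      then have "measurable (history M XL XR \<theta> (i - 1)) (count_space {1, 2})
          \<subseteq> measurable (past M XL XR n) (count_space {1, 2::nat})"
        by (intro measurable_mono) auto
      then show ?thesis using adm i by (auto simp: admissible_strategies_def)
    qed
    moreover have "reward XL XR \<theta> i \<in> borel_measurable (past M XL XR n)" if i: "1 \<le> i" "i < n"
    proof -
      have [measurable]: "\<theta> i \<in> measurable (past M XL XR n) (count_space {1, 2})" using \<theta> i by simp
      note [measurable] = arm_measurable_past[OF i]
      have "{\<omega> \<in> space (past M XL XR n). \<theta> i \<omega> = 1} \<in> sets (past M XL XR n)" by measurable
      then show ?thesis unfolding reward_def[abs_def] by (intro measurable_If) auto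
    qed
    ultimately show ?case by blast
  qed
  then show "1 \<le> i \<Longrightarrow> i \<le> n \<Longrightarrow> \<theta> i \<in> measurable (past M XL XR n) (count_space {1, 2})"
    and "1 \<le> i \<Longrightarrow> i < n \<Longrightarrow> reward XL XR \<theta> i \<in> borel_measurable (past M XL XR n)"
    by auto
qed

lemma total_reward_measurable_past:
  assumes "\<theta> \<in> admissible_strategies M XL XR"
  shows "total_reward XL XR \<theta> n \<in> borel_measurable (past M XL XR (Suc n))"
  unfolding total_reward_def[abs_def]
  by (intro borel_measurable_sum strategy_measurable_past assms) auto

lemma total_reward_Suc:
  "total_reward XL XR \<theta> (Suc n) \<omega> = total_reward XL XR \<theta> n \<omega> + reward XL XR \<theta> (Suc n) \<omega>"
  by (simp add: total_reward_def)

context prob_space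
begin

text \<open>The past before round \<open>n\<close> and one outcome of round \<open>n\<close> use
  disjoint index sets of the joint family. Nonnegative integrals keep the product rule valid when an
  exponential moment is infinite.\<close>

lemma nn_integral_past_mult:
  fixes f :: "'a \<Rightarrow> ennreal"
  assumes XL: "indep_vars (\<lambda>_. borel) XL {1..}" and XR: "indep_vars (\<lambda>_. borel) XR {1..}"
    and ind: "indep_sequences M XL XR" and n: "1 \<le> n"
    and f: "f \<in> borel_measurable (past M XL XR n)" and g: "g \<in> borel_measurable borel"
  shows "(\<integral>\<^sup>+\<omega>. f \<omega> * g (XL n \<omega>) \<partial>M) = (\<integral>\<^sup>+\<omega>. f \<omega> \<partial>M) * (\<integral>\<^sup>+\<omega>. g (XL n \<omega>) \<partial>M)"
    and "(\<integral>\<^sup>+\<omega>. f \<omega> * g (XR n \<omega>) \<partial>M) = (\<integral>\<^sup>+\<omega>. f \<omega> \<partial>M) * (\<integral>\<^sup>+\<omega>. g (XR n \<omega>) \<partial>M)"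
proof -
  let ?J = "{1..<n} <+> {1..<n}"
  let ?X = "case_sum XL XR"
  have all: "indep_vars (\<lambda>_. borel) ?X ({1..} <+> {1..})"
    using XL XR ind unfolding indep_sequences_def by (rule indep_vars_case_sum)
  have "(\<integral>\<^sup>+\<omega>. f \<omega> * g (?X k \<omega>) \<partial>M) = (\<integral>\<^sup>+\<omega>. f \<omega> \<partial>M) * (\<integral>\<^sup>+\<omega>. g (?X k \<omega>) \<partial>M)"
    if k: "k \<in> {1..} <+> {1..}" "k \<notin> ?J" for k
  proof -
    have ind: "indep_var (\<Pi>\<^sub>M j\<in>?J. borel) (\<lambda>\<omega>. \<lambda>j\<in>?J. ?X j \<omega>) (\<Pi>\<^sub>M j\<in>{k}. borel) (\<lambda>\<omega>. \<lambda>j\<in>{k}. ?X j \<omega>)"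
      using k by (intro indep_var_restrict[OF all]) auto
    have "(\<lambda>h. g (h k)) \<in> borel_measurable (\<Pi>\<^sub>M j\<in>{k}. borel)"
      by (rule measurable_compose[OF measurable_component_singleton[of k] g]) simp
    from indep_var_vimage_algebra_nn_integral_mult[OF ind f[unfolded past_def] this]
    show ?thesis by simp
  qed
  from this[of "Inl n"] this[of "Inr n"] n
  show "(\<integral>\<^sup>+\<omega>. f \<omega> * g (XL n \<omega>) \<partial>M) = (\<integral>\<^sup>+\<omega>. f \<omega> \<partial>M) * (\<integral>\<^sup>+\<omega>. g (XL n \<omega>) \<partial>M)"
    and "(\<integral>\<^sup>+\<omega>. f \<omega> * g (XR n \<omega>) \<partial>M) = (\<integral>\<^sup>+\<omega>. f \<omega> \<partial>M) * (\<integral>\<^sup>+\<omega>. g (XR n \<omega>) \<partial>M)"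
    by (auto simp: Plus_def image_iff)
qed

lemma total_reward_measurable:
  assumes XL: "iid_copies M WL XL" and XR: "iid_copies M WR XR"
    and adm: "\<theta> \<in> admissible_strategies M XL XR"
  shows "total_reward XL XR \<theta> n \<in> borel_measurable M"
  unfolding total_reward_def[abs_def]
proof (intro borel_measurable_sum)
  fix i assume "i \<in> {1..n}"
  then have [measurable]: "XL i \<in> borel_measurable M" "XR i \<in> borel_measurable M"
      "\<theta> i \<in> measurable M (count_space {1, 2})"
    using XL XR adm unfolding iid_copies_def indep_vars_def admissible_strategies_def by auto
  have "{\<omega> \<in> space M. \<theta> i \<omega> = 1} \<in> sets M" by measurable
  then show "reward XL XR \<theta> i \<in> borel_measurable M"
    unfolding reward_def[abs_def] by (intro measurable_If) auto
qed

text \<open>Splitting by the arm chosen in the last round leaves past-dependent weights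
  \<open>f\<close> and \<open>g\<close> that sum to the exponential of the earlier total. Each is
  multiplied by an independent outcome, and bounding both moments by the maximum removes the
  dependence on the strategy.\<close>

lemma nn_mgf_total_reward_le:
  assumes WL: "random_variable borel WL" and WR: "random_variable borel WR"
    and XL: "iid_copies M WL XL" and XR: "iid_copies M WR XR"
    and ind: "indep_sequences M XL XR" and adm: "\<theta> \<in> admissible_strategies M XL XR"
  shows "(\<integral>\<^sup>+\<omega>. ennreal (exp (t * total_reward XL XR \<theta> n \<omega>)) \<partial>M)
    \<le> (max (\<integral>\<^sup>+\<omega>. ennreal (exp (t * WL \<omega>)) \<partial>M) (\<integral>\<^sup>+\<omega>. ennreal (exp (t * WR \<omega>)) \<partial>M)) ^ n"
proof (induction n)
  case 0
  then show ?case by (simp add: total_reward_def emeasure_space_1)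
next
  case (Suc n)
  let ?e = "\<lambda>x. ennreal (exp (t * x))"
  let ?P = "past M XL XR (Suc n)"
  let ?S = "total_reward XL XR \<theta> n"
  let ?m = "max (\<integral>\<^sup>+\<omega>. ?e (WL \<omega>) \<partial>M) (\<integral>\<^sup>+\<omega>. ?e (WR \<omega>) \<partial>M)"
  have iv: "indep_vars (\<lambda>_. borel) XL {1..}" "indep_vars (\<lambda>_. borel) XR {1..}"
    using XL XR by (auto simp: iid_copies_def)
  have rv[measurable]: "random_variable borel (XL (Suc n))" "random_variable borel (XR (Suc n))"
    using iv by (auto simp: indep_vars_def)
  have sub: "sets ?P \<subseteq> events"
  proof -
    have "(\<lambda>\<omega>. \<lambda>j\<in>{1..<Suc n} <+> {1..<Suc n}. case_sum XL XR j \<omega>) \<in>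
        measurable M (\<Pi>\<^sub>M j\<in>{1..<Suc n} <+> {1..<Suc n}. borel)"
      using iv by (intro measurable_restrict) (auto simp: indep_vars_def)
    from measurable_sets[OF this] show ?thesis
      unfolding past_def by (subst sets_vimage_algebra2) (auto simp: space_PiM)
  qed
  \<comment> \<open>The past before round \<open>Suc n\<close> already determines the arm played in
    that round.\<close>
  have "\<theta> (Suc n) \<in> measurable ?P (count_space {1, 2})"
    by (rule strategy_measurable_past[OF adm]) auto
  from measurable_sets[OF this, of "{1}"]
  have [measurable]: "{\<omega> \<in> space M. \<theta> (Suc n) \<omega> = 1} \<in> sets ?P"
    by (simp add: vimage_def Int_def conj_commute)
  note [measurable] = total_reward_measurable_past[OF adm, of n]
  let ?A = "{\<omega> \<in> space M. \<theta> (Suc n) \<omega> = 1}"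
  define f where "f \<omega> = ?e (?S \<omega>) * indicator ?A \<omega>" for \<omega>
  define g where "g \<omega> = ?e (?S \<omega>) * indicator (space M - ?A) \<omega>" for \<omega>
  have f: "f \<in> borel_measurable ?P" unfolding f_def by measurable
  have "space ?P - ?A \<in> sets ?P" by (rule sets.compl_sets) measurable
  then have [measurable]: "space M - ?A \<in> sets ?P" by simp
  have g: "g \<in> borel_measurable ?P" unfolding g_def by measurable
  have fg[measurable]: "f \<in> borel_measurable M" "g \<in> borel_measurable M"
    using f g sub measurable_mono[of borel borel ?P M] by auto
  have law: "(\<integral>\<^sup>+\<omega>. ?e (XL (Suc n) \<omega>) \<partial>M) = (\<integral>\<^sup>+\<omega>. ?e (WL \<omega>) \<partial>M)"
      "(\<integral>\<^sup>+\<omega>. ?e (XR (Suc n) \<omega>) \<partial>M) = (\<integral>\<^sup>+\<omega>. ?e (WR \<omega>) \<partial>M)"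
  proof -
    have "(\<integral>\<^sup>+\<omega>. ?e (X (Suc n) \<omega>) \<partial>M) = (\<integral>\<^sup>+\<omega>. ?e (W \<omega>) \<partial>M)"
      if "iid_copies M W X" and [measurable]: "random_variable borel W" "random_variable borel (X (Suc n))" for X W
    proof -
      have "(\<integral>\<^sup>+x. ?e x \<partial>distr M borel (X (Suc n))) = (\<integral>\<^sup>+x. ?e x \<partial>distr M borel W)"
        using that by (simp add: iid_copies_def)
      then show ?thesis by (simp add: nn_integral_distr)
    qed
    then show "(\<integral>\<^sup>+\<omega>. ?e (XL (Suc n) \<omega>) \<partial>M) = (\<integral>\<^sup>+\<omega>. ?e (WL \<omega>) \<partial>M)"
      "(\<integral>\<^sup>+\<omega>. ?e (XR (Suc n) \<omega>) \<partial>M) = (\<integral>\<^sup>+\<omega>. ?e (WR \<omega>) \<partial>M)"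
      using XL XR WL WR rv by auto
  qed
  have "(\<integral>\<^sup>+\<omega>. ?e (total_reward XL XR \<theta> (Suc n) \<omega>) \<partial>M)
      = (\<integral>\<^sup>+\<omega>. f \<omega> * ?e (XL (Suc n) \<omega>) + g \<omega> * ?e (XR (Suc n) \<omega>) \<partial>M)"
    by (intro nn_integral_cong)
       (auto simp: f_def g_def total_reward_Suc reward_def distrib_left exp_add ennreal_mult)
  also have "\<dots> = (\<integral>\<^sup>+\<omega>. f \<omega> * ?e (XL (Suc n) \<omega>) \<partial>M) + (\<integral>\<^sup>+\<omega>. g \<omega> * ?e (XR (Suc n) \<omega>) \<partial>M)"
    by (rule nn_integral_add) measurable
  also have "(\<integral>\<^sup>+\<omega>. f \<omega> * ?e (XL (Suc n) \<omega>) \<partial>M) = (\<integral>\<^sup>+\<omega>. f \<omega> \<partial>M) * (\<integral>\<^sup>+\<omega>. ?e (WL \<omega>) \<partial>M)"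
    unfolding law[symmetric] by (rule nn_integral_past_mult(1)[OF iv ind _ f]) auto
  also have "(\<integral>\<^sup>+\<omega>. g \<omega> * ?e (XR (Suc n) \<omega>) \<partial>M) = (\<integral>\<^sup>+\<omega>. g \<omega> \<partial>M) * (\<integral>\<^sup>+\<omega>. ?e (WR \<omega>) \<partial>M)"
    unfolding law[symmetric] by (rule nn_integral_past_mult(2)[OF iv ind _ g]) auto
  also have "(\<integral>\<^sup>+\<omega>. f \<omega> \<partial>M) * (\<integral>\<^sup>+\<omega>. ?e (WL \<omega>) \<partial>M) + (\<integral>\<^sup>+\<omega>. g \<omega> \<partial>M) * (\<integral>\<^sup>+\<omega>. ?e (WR \<omega>) \<partial>M)
      \<le> (\<integral>\<^sup>+\<omega>. f \<omega> \<partial>M) * ?m + (\<integral>\<^sup>+\<omega>. g \<omega> \<partial>M) * ?m"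
    by (intro add_mono mult_left_mono) auto
  also have "\<dots> = ((\<integral>\<^sup>+\<omega>. f \<omega> \<partial>M) + (\<integral>\<^sup>+\<omega>. g \<omega> \<partial>M)) * ?m"
    by (simp add: distrib_right)
  also have "(\<integral>\<^sup>+\<omega>. f \<omega> \<partial>M) + (\<integral>\<^sup>+\<omega>. g \<omega> \<partial>M) = (\<integral>\<^sup>+\<omega>. f \<omega> + g \<omega> \<partial>M)"
    by (rule nn_integral_add[symmetric]) measurable
  also have "\<dots> = (\<integral>\<^sup>+\<omega>. ?e (?S \<omega>) \<partial>M)"
    by (intro nn_integral_cong) (auto simp: f_def g_def split: split_indicator)
  also have "\<dots> * ?m \<le> ?m ^ n * ?m"
    by (intro mult_right_mono Suc.IH) simp
  finally show ?case by (simp add: mult.commute)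
qed

end

subsection \<open>The rate function\<close>

lemma ereal_le_log_ennreal_iff: "ereal y \<le> log_ennreal z \<longleftrightarrow> ennreal (exp y) \<le> z"
proof (cases z)
  case (real r)
  then show ?thesis
    by (cases "r = 0") (auto simp: log_ennreal_def ennreal_le_iff ln_ge_iff ennreal_eq_0_iff)
qed (simp add: log_ennreal_def top_unique)

lemma log_ennreal_le_ereal_iff: "log_ennreal z \<le> ereal y \<longleftrightarrow> z \<le> ennreal (exp y)"
proof (cases z)
  case (real r)
  have "ln r \<le> y \<longleftrightarrow> r \<le> exp y" if "r > 0"
    using that by (metis exp_le_cancel_iff exp_ln)
  then show ?thesis using real
    by (cases "r = 0") (auto simp: log_ennreal_def ennreal_le_iff ennreal_eq_0_iff)
qed (simp add: log_ennreal_def top_unique)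

text \<open>The factor \<open>1/2\<close> left by the use of Chebyshev's inequality costs
  \<open>ln 2 / n\<close>, which vanishes.\<close>

lemma liminf_scaled_log_ge:
  assumes "eventually (\<lambda>n. ennreal (exp (- (r * real n)) / 2) \<le> \<nu> n) sequentially"
  shows "ereal (- r) \<le> liminf (\<lambda>n. ereal (1 / real n) * log_ennreal (\<nu> n))"
proof -
  have "(\<lambda>n. ereal (- r - ln 2 / real n)) \<longlonglongrightarrow> ereal (- r - 0)"
    by (intro tendsto_intros lim_const_over_n)
  then have "ereal (- r) = liminf (\<lambda>n. ereal (- r - ln 2 / real n))"
    using lim_imp_Liminf[OF trivial_limit_sequentially] by (metis diff_zero)
  also have "\<dots> \<le> liminf (\<lambda>n. ereal (1 / real n) * log_ennreal (\<nu> n))"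
  proof (rule Liminf_mono)
    show "\<forall>\<^sub>F n in sequentially. ereal (- r - ln 2 / real n) \<le> ereal (1 / real n) * log_ennreal (\<nu> n)"
      using assms eventually_gt_at_top[of 0]
    proof eventually_elim
      case (elim n)
      have "exp (- (r * real n)) / 2 = exp (- (r * real n) - ln 2)" by (simp add: exp_diff)
      then have "ereal (- (r * real n) - ln 2) \<le> log_ennreal (\<nu> n)"
        using elim by (simp add: ereal_le_log_ennreal_iff)
      then have "ereal (1 / real n) * ereal (- (r * real n) - ln 2) \<le> ereal (1 / real n) * log_ennreal (\<nu> n)"
        by (rule ereal_mult_left_mono) simp
      then show ?case using elim by (simp add: field_simps)
    qed
  qed
  finally show ?thesis .
qed

text \<open>The factor 2 counts the two half-lines into which a closed set is split.\<close>

lemma limsup_scaled_log_le: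
  assumes "eventually (\<lambda>n. \<nu> n \<le> ennreal (2 * exp (- (r * real n)))) sequentially"
  shows "limsup (\<lambda>n. ereal (1 / real n) * log_ennreal (\<nu> n)) \<le> ereal (- r)"
proof -
  have "(\<lambda>n. ereal (- r + ln 2 / real n)) \<longlonglongrightarrow> ereal (- r + 0)"
    by (intro tendsto_intros lim_const_over_n)
  then have "ereal (- r) = limsup (\<lambda>n. ereal (- r + ln 2 / real n))"
    using lim_imp_Limsup[OF trivial_limit_sequentially] by (metis add_0_right)
  moreover have "limsup (\<lambda>n. ereal (1 / real n) * log_ennreal (\<nu> n)) \<le> \<dots>"
  proof (rule Limsup_mono)
    show "\<forall>\<^sub>F n in sequentially. ereal (1 / real n) * log_ennreal (\<nu> n) \<le> ereal (- r + ln 2 / real n)"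
      using assms eventually_gt_at_top[of 0]
    proof eventually_elim
      case (elim n)
      have "2 * exp (- (r * real n)) = exp (- (r * real n) + ln 2)" by (simp only: exp_add) simp
      then have "log_ennreal (\<nu> n) \<le> ereal (- (r * real n) + ln 2)"
        using elim by (simp add: log_ennreal_le_ereal_iff)
      then have "ereal (1 / real n) * log_ennreal (\<nu> n) \<le> ereal (1 / real n) * ereal (- (r * real n) + ln 2)"
        by (rule ereal_mult_left_mono) simp
      then show ?case using elim by (simp add: field_simps)
    qed
  qed
  ultimately show ?thesis by simp
qed

section \<open>Legendre transforms\<close>

lemma closed_sublevel_legendre: "closed {x. legendre \<Lambda> x \<le> ereal a}"
proof -
  have "closed {x. ereal (t * x) - \<Lambda> t \<le> ereal a}" for t
  proof (cases "\<Lambda> t")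
    case (real l)
    have "closed {x. t * x - l \<le> a}"
      by (intro closed_Collect_le continuous_intros)
    then show ?thesis using real by simp
  qed auto
  moreover have "{x. legendre \<Lambda> x \<le> ereal a} = (\<Inter>t. {x. ereal (t * x) - \<Lambda> t \<le> ereal a})"
    by (auto simp: legendre_def SUP_le_iff)
  ultimately show ?thesis by (auto intro: closed_INT)
qed

lemma legendre_nonneg:
  assumes "\<Lambda> 0 = 0"
  shows "0 \<le> legendre \<Lambda> x"
  unfolding legendre_def by (rule SUP_upper2[of 0]) (auto simp: assms zero_ereal_def[symmetric])

lemma legendre_term_nonpos:
  assumes "ereal (t * c) \<le> L" "t * x \<le> t * c"
  shows "ereal (t * x) - L \<le> 0"
  using assms by (cases L) auto

text \<open>The parameter 0 already contributes 0 to the supremum for \<open>\<Lambda>'\<close>, so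
  nonpositive terms for \<open>\<Lambda>\<close> cannot exceed it. In the applications
  \<open>c\<close> is one of the means, and \<open>ereal (t * c) \<le> \<Lambda> t\<close> is
  Jensen's inequality.\<close>

lemma legendre_le_of_nonpos_terms:
  assumes "\<Lambda>' 0 = 0"
    and "\<And>t. \<Lambda> t = \<Lambda>' t \<or> (\<exists>c. ereal (t * c) \<le> \<Lambda> t \<and> t * x \<le> t * c)"
  shows "legendre \<Lambda> x \<le> legendre \<Lambda>' x"
  unfolding legendre_def[of \<Lambda>]
proof (rule SUP_least)
  fix t
  show "ereal (t * x) - \<Lambda> t \<le> legendre \<Lambda>' x"
    using assms(2)[of t]
  proof
    assume "\<Lambda> t = \<Lambda>' t"
    then show ?thesis unfolding legendre_def by (intro SUP_upper2[of t]) auto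
  next
    assume "\<exists>c. ereal (t * c) \<le> \<Lambda> t \<and> t * x \<le> t * c"
    then show ?thesis
      using legendre_term_nonpos legendre_nonneg[of \<Lambda>' x] assms(1) by (metis order_trans)
  qed
qed

lemma legendre_le_zero:
  assumes "\<And>t. \<exists>c. ereal (t * c) \<le> \<Lambda> t \<and> t * x \<le> t * c"
  shows "legendre \<Lambda> x \<le> 0"
  unfolding legendre_def using assms legendre_term_nonpos by (intro SUP_least) metis

context prob_space
begin

lemma log_mgf_0 [simp]: "log_mgf M W 0 = 0"
  by (simp add: log_mgf_def emeasure_space_1 log_ennreal_def)

text \<open>Jensen's inequality, from the tangent to the exponential function at
  \<open>t * expectation W\<close>; an infinite moment makes it trivial.\<close>

lemma mean_le_log_mgf:
  assumes W: "integrable M W"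
  shows "ereal (t * expectation W) \<le> log_mgf M W t"
proof -
  let ?m = "expectation W"
  have "ennreal (exp (t * ?m)) \<le> (\<integral>\<^sup>+\<omega>. ennreal (exp (t * W \<omega>)) \<partial>M)"
  proof (cases "(\<integral>\<^sup>+\<omega>. ennreal (exp (t * W \<omega>)) \<partial>M) = \<infinity>")
    case False
    have [measurable]: "W \<in> borel_measurable M" using W by auto
    have int: "integrable M (\<lambda>\<omega>. exp (t * W \<omega>))"
      using False by (intro integrableI_nonneg) (auto simp: less_top)
    have "exp (t * ?m) = (\<integral>\<omega>. exp (t * ?m) * (1 + t * (W \<omega> - ?m)) \<partial>M)"
      using W by (simp add: prob_space)
    also have "\<dots> \<le> (\<integral>\<omega>. exp (t * W \<omega>) \<partial>M)"
    proof (rule integral_mono)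
      fix \<omega>
      have "exp (t * ?m) * (1 + t * (W \<omega> - ?m)) \<le> exp (t * ?m) * exp (t * (W \<omega> - ?m))"
        by (intro mult_left_mono exp_ge_add_one_self) auto
      also have "\<dots> = exp (t * W \<omega>)" by (simp add: exp_add[symmetric] algebra_simps)
      finally show "exp (t * ?m) * (1 + t * (W \<omega> - ?m)) \<le> exp (t * W \<omega>)" .
    qed (use W int in auto)
    finally show ?thesis
      using int by (subst nn_integral_eq_integral) (auto intro: ennreal_leI)
  qed simp
  then show ?thesis by (simp add: log_mgf_def ereal_le_log_ennreal_iff)
qed

lemma bandit_rate_eq_legendre_max:
  assumes WL: "integrable M WL" and WR: "integrable M WR"
    and max: "\<And>t. max (log_mgf M WL t) (log_mgf M WR t) =
           (if t \<ge> 0 then log_mgf_upper M WL WR t else log_mgf_lower M WL WR t)"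
  shows "bandit_rate M WL WR x = legendre (\<lambda>t. max (log_mgf M WL t) (log_mgf M WR t)) x"
proof -
  let ?U = "log_mgf_upper M WL WR" and ?D = "log_mgf_lower M WL WR"
  let ?a = "max (expectation WL) (expectation WR)" and ?b = "min (expectation WL) (expectation WR)"
  have U: "ereal (t * ?a) \<le> ?U t" for t
    using mean_le_log_mgf[OF WL, of t] mean_le_log_mgf[OF WR, of t]
    by (auto simp: log_mgf_upper_def max_def)
  have D: "ereal (t * ?b) \<le> ?D t" for t
    using mean_le_log_mgf[OF WL, of t] mean_le_log_mgf[OF WR, of t]
    by (auto simp: log_mgf_lower_def min_def)
  have U0: "?U 0 = 0" and D0: "?D 0 = 0" by (simp_all add: log_mgf_upper_def log_mgf_lower_def)
  define \<Lambda> where "\<Lambda> t = (if t \<ge> 0 then ?U t else ?D t)" for t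
  have \<Lambda>0: "\<Lambda> 0 = 0" using U0 by (simp add: \<Lambda>_def)
  have ba: "?b \<le> ?a" by simp
  consider "x > ?a" | "x < ?b" | "?b \<le> x" "x \<le> ?a" by linarith
  then have "bandit_rate M WL WR x = legendre \<Lambda> x"
  proof cases
    case 1
    \<comment> \<open>For \<open>t \<ge> 0\<close> the functions \<open>?U\<close> and
      \<open>\<Lambda>\<close> agree. For \<open>t < 0\<close> they may differ, but \<open>x\<close>
      lies above both means, so both terms are nonpositive.\<close>
    have neg: "t * x \<le> t * ?a" "t * x \<le> t * ?b" if "t < 0" for t
      using that 1 ba by (auto intro!: mult_left_mono_neg)
    have *: "?U t = \<Lambda> t \<or> (\<exists>c. ereal (t * c) \<le> ?U t \<and> t * x \<le> t * c)" for t
        using U[of t] neg[of t] by (cases "t < 0") (auto simp: \<Lambda>_def)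
    have **: "\<Lambda> t = ?U t \<or> (\<exists>c. ereal (t * c) \<le> \<Lambda> t \<and> t * x \<le> t * c)" for t
        using D[of t] neg[of t] by (cases "t < 0") (auto simp: \<Lambda>_def)
    have "legendre ?U x = legendre \<Lambda> x"
    proof (intro antisym)
      show "legendre ?U x \<le> legendre \<Lambda> x" by (rule legendre_le_of_nonpos_terms[OF \<Lambda>0 *])
      show "legendre \<Lambda> x \<le> legendre ?U x" by (rule legendre_le_of_nonpos_terms[OF U0 **])
    qed
    then show ?thesis using 1 by (simp add: bandit_rate_def)
  next
    case 2
    have pos: "t * x \<le> t * ?a" "t * x \<le> t * ?b" if "t \<ge> 0" for t
      using that 2 ba by (auto intro!: mult_left_mono)
    have *: "?D t = \<Lambda> t \<or> (\<exists>c. ereal (t * c) \<le> ?D t \<and> t * x \<le> t * c)" for t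
        using D[of t] pos[of t] by (cases "t < 0") (auto simp: \<Lambda>_def)
    have **: "\<Lambda> t = ?D t \<or> (\<exists>c. ereal (t * c) \<le> \<Lambda> t \<and> t * x \<le> t * c)" for t
        using U[of t] pos[of t] by (cases "t < 0") (auto simp: \<Lambda>_def)
    have "legendre ?D x = legendre \<Lambda> x"
    proof (intro antisym)
      show "legendre ?D x \<le> legendre \<Lambda> x" by (rule legendre_le_of_nonpos_terms[OF \<Lambda>0 *])
      show "legendre \<Lambda> x \<le> legendre ?D x" by (rule legendre_le_of_nonpos_terms[OF D0 **])
    qed
    then show ?thesis using 2 by (simp add: bandit_rate_def)
  next
    case 3
    have "legendre \<Lambda> x \<le> 0"
    proof (rule legendre_le_zero)
      fix t
      \<comment> \<open>A point between the means lies below \<open>?a\<close> and above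
        \<open>?b\<close>, so each sign of \<open>t\<close> has its own mean as witness.\<close>
      show "\<exists>c. ereal (t * c) \<le> \<Lambda> t \<and> t * x \<le> t * c"
      proof (cases "t \<ge> 0")
        case True
        then show ?thesis using U[of t] 3 by (intro exI[of _ ?a]) (simp add: \<Lambda>_def mult_left_mono)
      next
        case False
        then show ?thesis using D[of t] 3 by (intro exI[of _ ?b]) (simp add: \<Lambda>_def mult_left_mono_neg)
      qed
    qed
    then have "legendre \<Lambda> x = 0" using legendre_nonneg[of \<Lambda> x] \<Lambda>0 by (intro antisym) auto
    moreover have "\<not> x > ?a" "\<not> x < ?b" using 3 by linarith+
    ultimately show ?thesis by (simp only: bandit_rate_def if_False)
  qed
  \<comment> \<open>The assumption on the maximum of the two generating functions enters
    here.\<close>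
  also have "\<Lambda> = (\<lambda>t. max (log_mgf M WL t) (log_mgf M WR t))"
    by (rule ext) (simp add: max \<Lambda>_def)
  finally show ?thesis .
qed

end

subsection \<open>The upper bound\<close>

context prob_space
begin

text \<open>The event is written with \<open>t\<close> times the reward, so one statement covers
  both tails. It is applied with \<open>c = t * p\<close> for a boundary point
  \<open>p\<close>.\<close>

lemma chernoff_total_reward:
  assumes WL: "random_variable borel WL" and WR: "random_variable borel WR"
    and XL: "iid_copies M WL XL" and XR: "iid_copies M WR XR"
    and ind: "indep_sequences M XL XR" and adm: "\<theta> \<in> admissible_strategies M XL XR"
    and le: "max (log_mgf M WL t) (log_mgf M WR t) \<le> ereal (c - r)"
  shows "emeasure M {\<omega>\<in>space M. real n * c \<le> t * total_reward XL XR \<theta> n \<omega>} \<le> ennreal (exp (- (r * real n)))"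
proof -
  let ?S = "total_reward XL XR \<theta> n"
  note [measurable] = total_reward_measurable[OF XL XR adm, of n]
  have m: "max (\<integral>\<^sup>+\<omega>. ennreal (exp (t * WL \<omega>)) \<partial>M) (\<integral>\<^sup>+\<omega>. ennreal (exp (t * WR \<omega>)) \<partial>M) \<le> ennreal (exp (c - r))"
    using le by (simp add: log_mgf_def log_ennreal_le_ereal_iff)
  have "emeasure M {\<omega>\<in>space M. real n * c \<le> t * ?S \<omega>}
      = (\<integral>\<^sup>+\<omega>. indicator {\<omega>\<in>space M. real n * c \<le> t * ?S \<omega>} \<omega> \<partial>M)"
    by (rule nn_integral_indicator[symmetric]) measurable
  also have "\<dots> \<le> (\<integral>\<^sup>+\<omega>. ennreal (exp (- (real n * c))) * ennreal (exp (t * ?S \<omega>)) \<partial>M)"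
    by (intro nn_integral_mono)
       (auto simp: ennreal_mult[symmetric] exp_add[symmetric] ennreal_ge_1 split: split_indicator)
  also have "\<dots> = ennreal (exp (- (real n * c))) * (\<integral>\<^sup>+\<omega>. ennreal (exp (t * ?S \<omega>)) \<partial>M)"
    by (rule nn_integral_cmult) measurable
  also have "\<dots> \<le> ennreal (exp (- (real n * c))) * ennreal (exp (c - r)) ^ n"
    using nn_mgf_total_reward_le[OF WL WR XL XR ind adm, of t n] m
    by (intro mult_left_mono order_trans[OF _ power_mono[OF m]]) simp_all
  also have "\<dots> = ennreal (exp (- (r * real n)))"
    by (simp add: ennreal_power ennreal_mult[symmetric] exp_of_nat_mult[symmetric] exp_add[symmetric] algebra_simps)
  finally show ?thesis .
qed

text \<open>If the infimum of the rate over \<open>F\<close> exceeds some \<open>r \<ge> 0\<close>,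
  then \<open>F\<close> avoids the interval of means. On each side its point \<open>p\<close>
  nearest to the means belongs to \<open>F\<close> because \<open>F\<close> is closed, and the
  parameter belonging to \<open>p\<close> controls that whole side.\<close>

lemma ldp_upper_bound:
  assumes WL: "integrable M WL" and WR: "integrable M WR"
    and XL: "iid_copies M WL XL" and XR: "iid_copies M WR XR"
    and ind: "indep_sequences M XL XR"
    and max: "\<And>t. max (log_mgf M WL t) (log_mgf M WR t) =
           (if t \<ge> 0 then log_mgf_upper M WL WR t else log_mgf_lower M WL WR t)"
    and F: "closed F"
  shows "limsup (\<lambda>n. ereal (1 / real n) * log_ennreal (sup_prob M XL XR n F))
    \<le> - (INF x\<in>F. bandit_rate M WL WR x)" (is "?l \<le> - ?I")
proof -
  have rv: "random_variable borel WL" "random_variable borel WR" using WL WR by auto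
  \<comment> \<open>Approaching \<open>?I\<close> from below also covers an infinite
    infimum.\<close>
  have "y \<le> - ?l" if y: "y < ?I" for y
  proof (cases y)
    case (real r)
    have "\<forall>\<^sub>F n in sequentially. sup_prob M XL XR n F \<le> ennreal (2 * exp (- (r * real n)))"
    proof (cases "r < 0")
      case True
      have "sup_prob M XL XR n F \<le> ennreal (2 * exp (- (r * real n)))" for n
      proof -
        have "sup_prob M XL XR n F \<le> 1"
          unfolding sup_prob_def by (intro SUP_least emeasure_le_1)
        also have "1 \<le> 2 * exp (- (r * real n))"
        proof -
          have "r * real n \<le> 0" using True by (intro mult_nonpos_nonneg) auto
          then have "1 \<le> exp (- (r * real n))" by simp
          then show ?thesis by linarith
        qed
        then have "1 \<le> ennreal (2 * exp (- (r * real n)))" by (simp only: ennreal_ge_1)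
        finally show ?thesis .
      qed
      then show ?thesis by simp
    next
      case False
      let ?a = "max (expectation WL) (expectation WR)" and ?b = "min (expectation WL) (expectation WR)"
      let ?\<Lambda> = "\<lambda>t. max (log_mgf M WL t) (log_mgf M WR t)"
      have rate: "ereal r < bandit_rate M WL WR x" if "x \<in> F" for x
        using y that unfolding real by (rule less_INF_D)
      \<comment> \<open>The strict inequalities come from \<open>r \<ge> 0\<close> and Jensen; they
        will determine the sign of \<open>t\<close>.\<close>
      have ex: "\<exists>t. ?\<Lambda> t \<le> ereal (t * x - r) \<and> (t * x > t * expectation WL) \<and> (t * x > t * expectation WR)"
        if x: "x \<in> F" for x
      proof -
        have "ereal r < legendre ?\<Lambda> x"
          using rate[OF x] bandit_rate_eq_legendre_max[OF WL WR max] by simp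
        then obtain t where t: "ereal r < ereal (t * x) - ?\<Lambda> t"
          unfolding legendre_def less_SUP_iff by blast
        have "ereal (t * expectation WL) \<le> ?\<Lambda> t" "ereal (t * expectation WR) \<le> ?\<Lambda> t"
          using mean_le_log_mgf[OF WL, of t] mean_le_log_mgf[OF WR, of t] by (auto simp: le_max_iff_disj)
        then show ?thesis using t False by (intro exI[of _ t]) (cases "?\<Lambda> t"; auto)
      qed
      have sides: "x > ?a \<or> x < ?b" if x: "x \<in> F" for x
      proof (rule ccontr)
        assume "\<not> ?thesis"
        then have "bandit_rate M WL WR x = 0" by (simp only: bandit_rate_def de_Morgan_disj if_False)
        then show False using rate[OF x] False by simp
      qed
      have bound: "emeasure M {\<omega>\<in>space M. total_reward XL XR \<theta> n \<omega> / real n \<in> A} \<le> ennreal (exp (- (r * real n)))"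
        if adm: "\<theta> \<in> admissible_strategies M XL XR" and n: "n > 0"
          and A: "A = {} \<or> (\<exists>p t. ?\<Lambda> t \<le> ereal (t * p - r) \<and> (\<forall>x\<in>A. t * p \<le> t * x))" for A \<theta> n
        using A
      proof (elim disjE exE conjE)
        fix p t assume t: "?\<Lambda> t \<le> ereal (t * p - r)" and p: "\<forall>x\<in>A. t * p \<le> t * x"
        have "{\<omega>\<in>space M. total_reward XL XR \<theta> n \<omega> / real n \<in> A}
            \<subseteq> {\<omega>\<in>space M. real n * (t * p) \<le> t * total_reward XL XR \<theta> n \<omega>}"
        proof safe
          fix \<omega> assume "total_reward XL XR \<theta> n \<omega> / real n \<in> A"
          with p have "t * p \<le> t * (total_reward XL XR \<theta> n \<omega> / real n)" by blast
          then show "real n * (t * p) \<le> t * total_reward XL XR \<theta> n \<omega>"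
            using n by (simp add: field_simps)
        qed
        then have "emeasure M {\<omega>\<in>space M. total_reward XL XR \<theta> n \<omega> / real n \<in> A}
            \<le> emeasure M {\<omega>\<in>space M. real n * (t * p) \<le> t * total_reward XL XR \<theta> n \<omega>}"
          using total_reward_measurable[OF XL XR adm, of n] by (intro emeasure_mono) measurable
        also have "\<dots> \<le> ennreal (exp (- (r * real n)))"
          by (rule chernoff_total_reward[OF rv XL XR ind adm t])
        finally show ?thesis .
      qed simp
      \<comment> \<open>A closed half-line ensures that the infimum is attained in the intersection;
        by \<open>sides\<close> the end point \<open>?a\<close> itself is not in
        \<open>F\<close>.\<close>
      have up: "F \<inter> {?a..} = {} \<or> (\<exists>p t. ?\<Lambda> t \<le> ereal (t * p - r) \<and> (\<forall>x\<in>F \<inter> {?a..}. t * p \<le> t * x))"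
      proof (cases "F \<inter> {?a..} = {}")
        case ne: False
        have bdd: "bdd_below (F \<inter> {?a..})" by (rule bdd_belowI[of _ ?a]) auto
        define p where "p = Inf (F \<inter> {?a..})"
        have p: "p \<in> F \<inter> {?a..}"
          unfolding p_def using F bdd ne by (intro closed_contains_Inf closed_Int) auto
        obtain t where t: "?\<Lambda> t \<le> ereal (t * p - r)" "t * p > t * expectation WL" "t * p > t * expectation WR"
          using ex[of p] p by blast
        have "t > 0"
        proof (rule ccontr)
          assume "\<not> t > 0"
          then have "t * p \<le> t * expectation WL" using p by (intro mult_left_mono_neg) auto
          then show False using t by simp
        qed
        then have "\<forall>x\<in>F \<inter> {?a..}. t * p \<le> t * x"
          using cInf_lower[OF _ bdd] by (simp add: p_def)
        then show ?thesis using t by blast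
      qed simp
      have down: "F \<inter> {..?b} = {} \<or> (\<exists>p t. ?\<Lambda> t \<le> ereal (t * p - r) \<and> (\<forall>x\<in>F \<inter> {..?b}. t * p \<le> t * x))"
      proof (cases "F \<inter> {..?b} = {}")
        case ne: False
        have bdd: "bdd_above (F \<inter> {..?b})" by (rule bdd_aboveI[of _ ?b]) auto
        define p where "p = Sup (F \<inter> {..?b})"
        have p: "p \<in> F \<inter> {..?b}"
          unfolding p_def using F bdd ne by (intro closed_contains_Sup closed_Int) auto
        obtain t where t: "?\<Lambda> t \<le> ereal (t * p - r)" "t * p > t * expectation WL" "t * p > t * expectation WR"
          using ex[of p] p by blast
        have "t < 0"
        proof (rule ccontr)
          assume "\<not> t < 0"
          then have "t * p \<le> t * expectation WL" using p by (intro mult_left_mono) auto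
          then show False using t by simp
        qed
        then have "\<forall>x\<in>F \<inter> {..?b}. t * p \<le> t * x"
          using cSup_upper[OF _ bdd] by (simp add: p_def)
        then show ?thesis using t by blast
      qed simp
      show ?thesis
        using eventually_gt_at_top[of 0]
      proof eventually_elim
        case (elim n)
        show ?case unfolding sup_prob_def
        proof (rule SUP_least)
          fix \<theta> assume adm: "\<theta> \<in> admissible_strategies M XL XR"
          let ?P = "\<lambda>A. {\<omega>\<in>space M. total_reward XL XR \<theta> n \<omega> / real n \<in> A}"
          note [measurable] = total_reward_measurable[OF XL XR adm, of n] borel_closed[OF F]
          have "F = F \<inter> {?a..} \<union> F \<inter> {..?b}" using sides by force
          then have "emeasure M (?P F) \<le> emeasure M (?P (F \<inter> {?a..}) \<union> ?P (F \<inter> {..?b}))"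
            by (intro emeasure_mono) (blast, measurable)
          also have "\<dots> \<le> emeasure M (?P (F \<inter> {?a..})) + emeasure M (?P (F \<inter> {..?b}))"
            by (rule emeasure_subadditive) measurable
          also have "\<dots> \<le> ennreal (exp (- (r * real n))) + ennreal (exp (- (r * real n)))"
            by (intro add_mono bound[OF adm elim up] bound[OF adm elim down])
          also have "\<dots> = ennreal (2 * exp (- (r * real n)))"
            by (simp add: ennreal_plus[symmetric] del: ennreal_plus)
          finally show "emeasure M (?P F) \<le> ennreal (2 * exp (- (r * real n)))" .
        qed
      qed
    qed
    then have "?l \<le> ereal (- r)" by (rule limsup_scaled_log_le)
    then show ?thesis using real ereal_minus_le_minus by fastforce
  qed (use y in auto)
  then have "?I \<le> - ?l" by (rule dense_le)
  then show ?thesis using ereal_minus_le_minus by fastforce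
qed

end

subsection \<open>The lower bound\<close>

text \<open>Deterministic choices are constant on the space, hence measurable for every history,
  even the trivial one. The values \<open>k = n\<close> and \<open>k = 0\<close> give the two pure
  strategies.\<close>

lemma switching_strategy_admissible:
  "(\<lambda>i \<omega>. if i \<le> k then 1 else 2) \<in> admissible_strategies M XL XR"
  by (auto simp: admissible_strategies_def)

lemma total_reward_switching:
  assumes "k \<le> n"
  shows "total_reward XL XR (\<lambda>i \<omega>. if i \<le> k then 1 else 2) n \<omega>
    = (\<Sum>i\<in>{1..k}. XL i \<omega>) + (\<Sum>i\<in>{k<..n}. XR i \<omega>)"
proof -
  have "{1..n} = {1..k} \<union> {k<..n}" using assms by auto
  then have "total_reward XL XR (\<lambda>i \<omega>. if i \<le> k then 1 else 2) n \<omega>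
      = (\<Sum>i\<in>{1..k} \<union> {k<..n}. if i \<le> k then XL i \<omega> else XR i \<omega>)"
    unfolding total_reward_def reward_def by (intro sum.cong) auto
  also have "\<dots> = (\<Sum>i\<in>{1..k}. XL i \<omega>) + (\<Sum>i\<in>{k<..n}. XR i \<omega>)"
    by (subst sum.union_disjoint) auto
  finally show ?thesis .
qed

lemma sup_prob_ge_switching:
  assumes "k \<le> n"
  shows "emeasure M {\<omega>\<in>space M. ((\<Sum>i\<in>{1..k}. XL i \<omega>) + (\<Sum>i\<in>{k<..n}. XR i \<omega>)) / real n \<in> A}
    \<le> sup_prob M XL XR n A"
  unfolding sup_prob_def total_reward_switching[OF assms, symmetric]
  by (rule SUP_upper) (rule switching_strategy_admissible)

context prob_space
begin

text \<open>A Legendre transform below \<open>r'\<close> at \<open>x\<close> says that the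
  generating function of \<open>W - x\<close> is at least \<open>exp (- r')\<close> everywhere.
  Choosing \<open>r' < r\<close> provides the strict gap that \<open>cramer_lower\<close>
  requires.\<close>

lemma cramer_lower_iid:
  assumes W[measurable]: "random_variable borel W" and X: "iid_copies M W X"
    and G: "open G" "x \<in> G" and r: "legendre (log_mgf M W) x < ereal r"
  shows "\<forall>\<^sub>F n in sequentially. ennreal (exp (- (r * real n)) / 2)
    \<le> emeasure M {\<omega>\<in>space M. (\<Sum>i\<in>{1..n}. X i \<omega>) / real n \<in> G}"
proof -
  obtain \<delta> where \<delta>: "\<delta> > 0" "ball x \<delta> \<subseteq> G" using G openE by blast
  obtain r' where r': "legendre (log_mgf M W) x < ereal r'" "r' < r"
    using ereal_dense2[OF r] by auto
  define \<mu> where "\<mu> = distr M borel (\<lambda>\<omega>. W \<omega> - x)"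
  interpret L: prob_space \<mu> unfolding \<mu>_def by (rule prob_space_distr) measurable
  have S: "sets \<mu> = sets borel" by (simp add: \<mu>_def)
  have mgf: "ennreal (exp (- r')) \<le> (\<integral>\<^sup>+y. ennreal (exp (t * y)) \<partial>\<mu>)" for t
  proof -
    have "ereal (t * x) - log_mgf M W t \<le> legendre (log_mgf M W) x"
      unfolding legendre_def by (rule SUP_upper) simp
    then have "ereal (t * x) - log_mgf M W t \<le> ereal r'" using r' by (metis less_imp_le order_trans)
    then have "ereal (t * x - r') \<le> log_mgf M W t" by (cases "log_mgf M W t") auto
    then have "ennreal (exp (t * x - r')) \<le> (\<integral>\<^sup>+\<omega>. ennreal (exp (t * W \<omega>)) \<partial>M)"
      by (simp add: log_mgf_def ereal_le_log_ennreal_iff)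
    then have "ennreal (exp (- (t * x))) * ennreal (exp (t * x - r'))
        \<le> ennreal (exp (- (t * x))) * (\<integral>\<^sup>+\<omega>. ennreal (exp (t * W \<omega>)) \<partial>M)"
      by (rule mult_left_mono) simp
    also have "\<dots> = (\<integral>\<^sup>+\<omega>. ennreal (exp (- (t * x))) * ennreal (exp (t * W \<omega>)) \<partial>M)"
      by (rule nn_integral_cmult[symmetric]) measurable
    also have "\<dots> = (\<integral>\<^sup>+y. ennreal (exp (t * y)) \<partial>\<mu>)"
      unfolding \<mu>_def by (subst nn_integral_distr)
        (auto simp: ennreal_mult[symmetric] exp_add[symmetric] algebra_simps)
    finally show ?thesis by (simp add: ennreal_mult[symmetric] exp_add[symmetric])
  qed
  have "\<forall>\<^sub>F n in sequentially. ennreal (exp (- r) ^ n / 2)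
      \<le> (walk_step \<mu> ^^ n) (indicator {u. \<bar>u\<bar> < real n * \<delta>}) 0"
    using mgf r' \<delta> by (intro cramer_lower[where c="exp (- r')"] L.finite_measure S) auto
  then show ?thesis
    using eventually_gt_at_top[of 0]
  proof eventually_elim
    case (elim n)
    have "exp (- (r * real n)) = exp (- r) ^ n"
      by (simp add: exp_of_nat_mult[symmetric] mult.commute)
    then have "ennreal (exp (- (r * real n)) / 2) \<le> (walk_step \<mu> ^^ card {1..n}) (indicator {u. \<bar>u\<bar> < real n * \<delta>}) 0"
      using elim by simp
    also have "\<dots> = emeasure M {\<omega>\<in>space M. (\<Sum>i\<in>{1..n}. X i \<omega>) - real (card {1..n}) * x \<in> {u. \<bar>u\<bar> < real n * \<delta>}}"
      unfolding \<mu>_def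
    proof (rule emeasure_centred_sum[symmetric])
      show "indep_vars (\<lambda>_. borel) X {1..n}"
        using X by (auto simp: iid_copies_def intro: indep_vars_subset)
      show "distr M borel (X i) = distr M borel W" if "i \<in> {1..n}" for i
        using X that by (simp add: iid_copies_def)
    qed auto
    also have "\<dots> \<le> emeasure M {\<omega>\<in>space M. (\<Sum>i\<in>{1..n}. X i \<omega>) / real n \<in> G}"
    proof (intro emeasure_mono)
      have "(\<Sum>i\<in>{1..n}. X i \<omega>) / real n \<in> G" if "\<bar>(\<Sum>i\<in>{1..n}. X i \<omega>) - real n * x\<bar> < real n * \<delta>" for \<omega>
      proof -
        have "dist x ((\<Sum>i\<in>{1..n}. X i \<omega>) / real n) = \<bar>(\<Sum>i\<in>{1..n}. X i \<omega>) - real n * x\<bar> / real n"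
        proof -
          have "x - (\<Sum>i\<in>{1..n}. X i \<omega>) / real n = - (((\<Sum>i\<in>{1..n}. X i \<omega>) - real n * x) / real n)"
            using elim by (simp add: field_simps)
          then show ?thesis by (simp only: dist_real_def abs_minus_cancel abs_divide abs_of_nat)
        qed
        also have "\<dots> < \<delta>" using that elim by (simp add: field_simps)
        finally show ?thesis using \<delta>(2) by auto
      qed
      then show "{\<omega>\<in>space M. (\<Sum>i\<in>{1..n}. X i \<omega>) - real (card {1..n}) * x \<in> {u. \<bar>u\<bar> < real n * \<delta>}}
          \<subseteq> {\<omega>\<in>space M. (\<Sum>i\<in>{1..n}. X i \<omega>) / real n \<in> G}" by auto
      have "random_variable borel (\<lambda>\<omega>. \<Sum>i\<in>{1..n}. X i \<omega>)"
        using X by (intro borel_measurable_sum) (auto simp: iid_copies_def indep_vars_def)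
      then show "{\<omega>\<in>space M. (\<Sum>i\<in>{1..n}. X i \<omega>) / real n \<in> G} \<in> events"
        using borel_open[OF G(1)] by measurable
    qed
    finally show ?case .
  qed
qed

text \<open>The blocks vary with \<open>n\<close> and may stay short or be empty, so the bound is
  uniform over all blocks of at most \<open>n\<close> rounds and the deviation is measured on the
  scale of \<open>n\<close>. The value \<open>1/4\<close> for each arm leaves probability
  \<open>1/2\<close>.\<close>

lemma deviation_iid_le:
  assumes W: "integrable M W" and var: "integrable M (\<lambda>\<omega>. (W \<omega> - expectation W)\<^sup>2)"
    and X: "iid_copies M W X" and \<epsilon>: "\<epsilon> > 0"
  shows "\<forall>\<^sub>F n in sequentially. \<forall>I\<subseteq>{1..}. finite I \<longrightarrow> card I \<le> n \<longrightarrow>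
    emeasure M {\<omega>\<in>space M. real n * \<epsilon> \<le> \<bar>(\<Sum>i\<in>I. X i \<omega>) - real (card I) * expectation W\<bar>} \<le> ennreal (1/4)"
proof -
  have [measurable]: "random_variable borel W" using W by auto
  let ?\<nu> = "distr M borel (\<lambda>\<omega>. W \<omega> - expectation W)"
  let ?v = "\<integral>x. x\<^sup>2 \<partial>?\<nu>"
  have "(\<lambda>n. ?v / \<epsilon>\<^sup>2 / real n) \<longlonglongrightarrow> 0" by (rule lim_const_over_n)
  then have "\<forall>\<^sub>F n in sequentially. ?v / \<epsilon>\<^sup>2 / real n < 1/4" by (rule order_tendstoD) simp
  then show ?thesis
    using eventually_gt_at_top[of 0]
  proof eventually_elim
    case (elim n)
    show ?case
    proof (intro allI impI)
      fix I :: "nat set" assume I: "I \<subseteq> {1..}" "finite I" "card I \<le> n"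
      have "emeasure M {\<omega>\<in>space M. real n * \<epsilon> \<le> \<bar>(\<Sum>i\<in>I. X i \<omega>) - real (card I) * expectation W\<bar>}
          = emeasure M {\<omega>\<in>space M. (\<Sum>i\<in>I. X i \<omega>) - real (card I) * expectation W \<in> {u. real n * \<epsilon> \<le> \<bar>u\<bar>}}"
        by simp
      also have "\<dots> = (walk_step ?\<nu> ^^ card I) (indicator {u. real n * \<epsilon> \<le> \<bar>u\<bar>}) 0"
      proof (rule emeasure_centred_sum)
        show "indep_vars (\<lambda>_. borel) X I"
          using X I by (auto simp: iid_copies_def intro: indep_vars_subset)
        show "distr M borel (X i) = distr M borel W" if "i \<in> I" for i
          using X I that by (auto simp: iid_copies_def)
      qed (use I in auto)
      also have "\<dots> \<le> ennreal (real (card I) * ?v / (real n * \<epsilon>)\<^sup>2)"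
        using W var \<epsilon> elim
        by (intro walk_chebyshev prob_space_distr) (auto simp: integrable_distr_eq integral_distr prob_space)
      also have "\<dots> \<le> ennreal (1/4)"
      proof (rule ennreal_leI)
        have "real (card I) * ?v / (real n * \<epsilon>)\<^sup>2 \<le> real n * ?v / (real n * \<epsilon>)\<^sup>2"
          using I by (intro divide_right_mono mult_right_mono) auto
        also have "\<dots> = ?v / \<epsilon>\<^sup>2 / real n" using elim by (simp add: power2_eq_square field_simps)
        finally show "real (card I) * ?v / (real n * \<epsilon>)\<^sup>2 \<le> 1/4" using elim by linarith
      qed
      finally show "emeasure M {\<omega>\<in>space M. real n * \<epsilon> \<le> \<bar>(\<Sum>i\<in>I. X i \<omega>) - real (card I) * expectation W\<bar>} \<le> ennreal (1/4)" .
    qed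
  qed
qed

text \<open>A mean value \<open>p \<mu>\<^sub>L + (1 - p) \<mu>\<^sub>R\<close> is reached by playing the left arm in the first
  \<open>\<lfloor>p n\<rfloor>\<close> rounds and the right arm afterwards.\<close>

lemma sup_prob_between_means:
  assumes WL: "integrable M WL" "integrable M (\<lambda>\<omega>. (WL \<omega> - expectation WL)\<^sup>2)" "iid_copies M WL XL"
    and WR: "integrable M WR" "integrable M (\<lambda>\<omega>. (WR \<omega> - expectation WR)\<^sup>2)" "iid_copies M WR XR"
    and G: "open G" "x \<in> G"
    and p: "0 \<le> p" "p \<le> 1" "x = p * expectation WL + (1 - p) * expectation WR"
  shows "\<forall>\<^sub>F n in sequentially. ennreal (1/2) \<le> sup_prob M XL XR n G"
proof -
  let ?l = "expectation WL" and ?r = "expectation WR"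
  obtain \<delta> where \<delta>: "\<delta> > 0" "ball x \<delta> \<subseteq> G" using G openE by blast
  \<comment> \<open>Three errors share the radius: the fluctuation of each arm, and the rounding of
    \<open>p * n\<close> to an integer.\<close>
  have \<epsilon>: "\<delta> / 3 > 0" using \<delta> by simp
  have "(\<lambda>n. \<bar>?l - ?r\<bar> / real n) \<longlonglongrightarrow> 0" by (rule lim_const_over_n)
  then have "\<forall>\<^sub>F n in sequentially. \<bar>?l - ?r\<bar> / real n < \<delta> / 3" using \<epsilon> by (rule order_tendstoD)
  then show ?thesis
    using deviation_iid_le[OF WL \<epsilon>] deviation_iid_le[OF WR \<epsilon>] eventually_gt_at_top[of 0]
  proof eventually_elim
    case (elim n)
    define k where "k = nat \<lfloor>p * real n\<rfloor>"
    have k: "real k \<le> p * real n" "p * real n < real k + 1"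
      using p by (auto simp: k_def)
    have "p * real n \<le> real n" using p by (simp add: mult_left_le_one_le)
    then have kn: "k \<le> n" using k by linarith
    let ?A = "\<lambda>\<omega>. (\<Sum>i\<in>{1..k}. XL i \<omega>)" and ?B = "\<lambda>\<omega>. (\<Sum>i\<in>{k<..n}. XR i \<omega>)"
    let ?EA = "{\<omega>\<in>space M. real n * (\<delta> / 3) \<le> \<bar>?A \<omega> - real k * ?l\<bar>}"
    let ?EB = "{\<omega>\<in>space M. real n * (\<delta> / 3) \<le> \<bar>?B \<omega> - real (n - k) * ?r\<bar>}"
    let ?E = "{\<omega>\<in>space M. (?A \<omega> + ?B \<omega>) / real n \<in> G}"
    have [measurable]: "random_variable borel ?A" "random_variable borel ?B"
      using WL(3) WR(3) by (auto intro!: borel_measurable_sum simp: iid_copies_def indep_vars_def)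
    have [measurable]: "G \<in> sets borel" using G by simp
    have EA: "emeasure M ?EA \<le> ennreal (1/4)"
      using elim(2)[rule_format, of "{1..k}"] kn by auto
    have EB: "emeasure M ?EB \<le> ennreal (1/4)"
    proof -
      have "{k<..n} \<subseteq> {1..}" by auto
      from elim(3)[rule_format, OF this] show ?thesis by simp
    qed
    have good: "(?A \<omega> + ?B \<omega>) / real n \<in> G"
      if "\<bar>?A \<omega> - real k * ?l\<bar> < real n * (\<delta> / 3)" "\<bar>?B \<omega> - real (n - k) * ?r\<bar> < real n * (\<delta> / 3)" for \<omega>
    proof -
      have eq: "?A \<omega> + ?B \<omega> - real n * x
          = (?A \<omega> - real k * ?l) + (?B \<omega> - real (n - k) * ?r) - (p * real n - real k) * (?l - ?r)"
        using kn by (simp add: p(3) of_nat_diff algebra_simps)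
      have "\<bar>(p * real n - real k) * (?l - ?r)\<bar> \<le> 1 * \<bar>?l - ?r\<bar>"
        unfolding abs_mult using k by (intro mult_right_mono) auto
      also have "\<dots> < real n * (\<delta> / 3)" using elim by (simp add: field_simps)
      finally have less: "\<bar>?A \<omega> + ?B \<omega> - real n * x\<bar> < real n * \<delta>"
        unfolding eq using that by linarith
      have "x - (?A \<omega> + ?B \<omega>) / real n = - ((?A \<omega> + ?B \<omega> - real n * x) / real n)"
        using elim by (simp add: field_simps)
      then have "dist x ((?A \<omega> + ?B \<omega>) / real n) = \<bar>?A \<omega> + ?B \<omega> - real n * x\<bar> / real n"
        by (simp only: dist_real_def abs_minus_cancel abs_divide abs_of_nat)
      also have "\<dots> < \<delta>" using less elim by (simp add: pos_divide_less_eq mult.commute)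
      finally have "dist x ((?A \<omega> + ?B \<omega>) / real n) < \<delta>" .
      then show ?thesis using \<delta>(2) by auto
    qed
    have "ennreal 1 = emeasure M (space M)" by (simp add: emeasure_space_1)
    also have "\<dots> \<le> emeasure M (?E \<union> (?EA \<union> ?EB))"
      by (intro emeasure_mono) (use good in \<open>force simp: not_le\<close>, measurable)
    also have "\<dots> \<le> emeasure M ?E + emeasure M (?EA \<union> ?EB)"
      by (rule emeasure_subadditive) measurable
    also have "\<dots> \<le> emeasure M ?E + (emeasure M ?EA + emeasure M ?EB)"
      by (intro add_left_mono emeasure_subadditive) measurable
    also have "\<dots> \<le> emeasure M ?E + (ennreal (1/4) + ennreal (1/4))"
      by (intro add_left_mono add_mono EA EB)
    also have "ennreal (1/4) + ennreal (1/4) = ennreal (1/2)"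
      by (subst ennreal_plus[symmetric]) auto
    finally have "ennreal (1/2) + ennreal (1/2) \<le> ennreal (1/2) + emeasure M ?E"
      by (subst ennreal_plus[symmetric]) (auto simp: add.commute)
    then have "ennreal (1/2) \<le> emeasure M ?E"
      by (simp only: ennreal_add_left_cancel_le) auto
    also have "\<dots> \<le> sup_prob M XL XR n G" by (rule sup_prob_ge_switching[OF kn])
    finally show ?case .
  qed
qed

lemma ldp_lower_bound:
  assumes WL: "integrable M WL" "integrable M (\<lambda>\<omega>. (WL \<omega> - expectation WL)\<^sup>2)" "iid_copies M WL XL"
    and WR: "integrable M WR" "integrable M (\<lambda>\<omega>. (WR \<omega> - expectation WR)\<^sup>2)" "iid_copies M WR XR"
    and G: "open G"
  shows "- (INF x\<in>G. bandit_rate M WL WR x)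
    \<le> liminf (\<lambda>n. ereal (1 / real n) * log_ennreal (sup_prob M XL XR n G))" (is "_ \<le> ?l")
proof -
  have "- ?l \<le> bandit_rate M WL WR x" if x: "x \<in> G" for x
  proof -
    have rv: "random_variable borel WL" "random_variable borel WR" using WL WR by auto
    \<comment> \<open>Kept for either arm, since which of them has the larger mean is decided only
      inside \<open>log_mgf_upper\<close> and \<open>log_mgf_lower\<close>.\<close>
    have cramer: "- ?l \<le> legendre (log_mgf M W) x" if W: "W = WL \<or> W = WR" for W
    proof (rule dense_ge)
      fix y assume y: "legendre (log_mgf M W) x < y"
      show "- ?l \<le> y"
      proof (cases y)
        case (real r)
        have "\<forall>\<^sub>F n in sequentially. ennreal (exp (- (r * real n)) / 2) \<le> sup_prob M XL XR n G"
          using W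
        proof
          assume W: "W = WL"
          have "\<forall>\<^sub>F n in sequentially. ennreal (exp (- (r * real n)) / 2)
              \<le> emeasure M {\<omega>\<in>space M. (\<Sum>i\<in>{1..n}. XL i \<omega>) / real n \<in> G}"
            using y real W by (intro cramer_lower_iid[OF rv(1) WL(3) G x]) simp
          then show ?thesis
          proof eventually_elim
            case (elim n)
            with sup_prob_ge_switching[of n n M XL XR G] show ?case by (auto intro: order_trans)
          qed
        next
          assume W: "W = WR"
          have "\<forall>\<^sub>F n in sequentially. ennreal (exp (- (r * real n)) / 2)
              \<le> emeasure M {\<omega>\<in>space M. (\<Sum>i\<in>{1..n}. XR i \<omega>) / real n \<in> G}"
            using y real W by (intro cramer_lower_iid[OF rv(2) WR(3) G x]) simp
          then show ?thesis
          proof eventually_elim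
            case (elim n)
            have "{0<..n} = {1..n}" by auto
            with elim sup_prob_ge_switching[of 0 n M XL XR G] show ?case by (auto intro: order_trans)
          qed
        qed
        then have "ereal (- r) \<le> ?l" by (rule liminf_scaled_log_ge)
        then show ?thesis using real by (simp add: ereal_uminus_le_reorder)
      qed (use y in auto)
    qed
    let ?a = "max (expectation WL) (expectation WR)" and ?b = "min (expectation WL) (expectation WR)"
    consider "x > ?a" | "\<not> x > ?a" "x < ?b" | "\<not> x > ?a" "\<not> x < ?b" by blast
    then show ?thesis
    proof cases
      case 1
      then have "bandit_rate M WL WR x = legendre (log_mgf_upper M WL WR) x"
        by (simp only: bandit_rate_def if_True)
      then show ?thesis using cramer by (simp add: log_mgf_upper_def)
    next
      case 2
      then have "bandit_rate M WL WR x = legendre (log_mgf_lower M WL WR) x"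
        by (simp only: bandit_rate_def if_True if_False)
      then show ?thesis using cramer by (simp add: log_mgf_lower_def)
    next
      case 3
      have "x \<in> closed_segment (expectation WR) (expectation WL)"
        using 3 unfolding closed_segment_eq_real_ivl by (auto simp: max_def min_def split: if_splits)
      then obtain p where p: "0 \<le> p" "p \<le> 1" "x = (1 - p) * expectation WR + p * expectation WL"
        by (auto simp: in_segment)
      then have px: "x = p * expectation WL + (1 - p) * expectation WR" by simp
      \<comment> \<open>The bound \<open>1/2\<close> is written with exponential rate 0 to fit
        \<open>liminf_scaled_log_ge\<close>.\<close>
      have "\<forall>\<^sub>F n in sequentially. ennreal (exp (- (0 * real n)) / 2) \<le> sup_prob M XL XR n G"
        using sup_prob_between_means[OF WL WR G x p(1,2) px] by simp
      then have "ereal (- 0) \<le> ?l" by (rule liminf_scaled_log_ge)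
      moreover have "bandit_rate M WL WR x = 0"
        using 3 by (simp only: bandit_rate_def if_False)
      ultimately show ?thesis by (simp add: zero_ereal_def[symmetric] ereal_uminus_le_reorder)
    qed
  qed
  then have "- ?l \<le> (INF x\<in>G. bandit_rate M WL WR x)" by (rule INF_greatest)
  then show ?thesis by (simp add: ereal_uminus_le_reorder)
qed

end

theorem theorem3p4:
  fixes M :: "'a measure"
    and WL WR :: "'a \<Rightarrow> real"
    and XL XR :: "nat \<Rightarrow> 'a \<Rightarrow> real"
  assumes "prob_space M"
    and "WL \<in> borel_measurable M" and "WR \<in> borel_measurable M"
    and "integrable M WL" and "integrable M WR"
    and "integrable M (\<lambda>\<omega>. (WL \<omega> - integral\<^sup>L M WL)\<^sup>2)"
    and "integrable M (\<lambda>\<omega>. (WR \<omega> - integral\<^sup>L M WR)\<^sup>2)"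
    and "iid_copies M WL XL" and "iid_copies M WR XR"
    and "indep_sequences M XL XR"
    and "\<And>t::real. max (log_mgf M WL t) (log_mgf M WR t) =
           (if t \<ge> 0 then log_mgf_upper M WL WR t else log_mgf_lower M WL WR t)"
  shows "large_deviation_principle (\<lambda>n. real n) (sup_prob M XL XR) (bandit_rate M WL WR)"
proof -
  interpret prob_space M by fact
  let ?\<Lambda> = "\<lambda>t. max (log_mgf M WL t) (log_mgf M WR t)"
  have rate: "bandit_rate M WL WR = legendre ?\<Lambda>"
    by (rule ext) (rule bandit_rate_eq_legendre_max[OF assms(4,5,11)])
  \<comment> \<open>As a single Legendre transform the rate is a supremum of affine or constant
    functions, hence lower semicontinuous; it is nonnegative because both generating functions have
    logarithm 0 at 0.\<close>
  have "rate_function (bandit_rate M WL WR)"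
    unfolding rate_function_def rate
    using closed_sublevel_legendre legendre_nonneg[of ?\<Lambda>] by auto
  then show ?thesis
    unfolding large_deviation_principle_def
    using ldp_upper_bound[OF assms(4,5,8-11)] ldp_lower_bound[OF assms(4,6,8,5,7,9)] by blast
qed

end
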